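(* Let $(a,b)$ be a multiplicatively dependent pair of integers with $1<a<b$. Then for any integers $\varepsilon,\delta$ with $0<|\varepsilon|<\frac14\sqrt{a}$ and $0<|\delta|<\frac14\sqrt{b}$, the pair $(a+\varepsilon,b+\delta)$ is multiplicatively independent.
   Context: An $n$-tuple $(z_1,\ldots,z_n)\in\mathbb{C}^n$ is called multiplicatively dependent if there exists a non-zero integer vector $(k_1,\ldots,k_n)\in\mathbb{Z}^n$ such that $z_1^{k_1}\cdots z_n^{k_n}=1$; otherwise it is called multiplicatively independent. *)

theory Defs
  imports Complex_Main
begin

text \<open>
  An n-tuple of complex numbers is a list of length n.  The definition also covers tuples with a
  zero entry: as \<open>0 powi k = 0\<close> for every \<open>k \<noteq> 0\<close>, a zero entry can only occur with exponent
  0 in a multiplicative relation.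
\<close>

definition mult_dependent :: "complex list \<Rightarrow> bool" where
  "mult_dependent zs \<longleftrightarrow>
     (\<exists>ks :: int list. length ks = length zs \<and> (\<exists>i<length zs. ks ! i \<noteq> 0) \<and>
        (\<Prod>i<length zs. (zs ! i) powi (ks ! i)) = 1)"

definition mult_independent :: "complex list \<Rightarrow> bool" where
  "mult_independent zs \<longleftrightarrow> \<not> mult_dependent zs"

end

theory Submission
  imports Defs "HOL-Analysis.Analysis" "HOL-Computational_Algebra.Nth_Powers"
begin

text \<open>
  Write \<open>a = g ^ p\<close>, \<open>b = g ^ q\<close> and suppose \<open>a + \<epsilon> = h ^ r\<close>, \<open>b + \<delta> = h ^ s\<close>, with coprime exponents
  in both pairs. If \<open>p / q = r / s\<close>, the pairs of exponents agree, and distinct \<open>q\<close>-th powers are too far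
  apart for \<open>\<delta>\<close>. Otherwise let \<open>u < v\<close> be \<open>a\<close> and \<open>a + \<epsilon>\<close> in increasing order. The nearly equal numbers
  \<open>b\<close> and \<open>b + \<delta>\<close> are \<open>u ^ N\<^sub>1 * Y\<close> and \<open>v ^ N\<^sub>2 * X\<close> with \<open>Y < u\<close>, \<open>X < v\<close>, in some order, and the exponents
  are large because \<open>(v / u) ^ s\<close> is about a positive power of \<open>g\<close>.

  The polynomials \<open>P\<close>, \<open>Q\<close> with \<open>v ^ N\<^sub>2 * Q = (-1) ^ m * u ^ N\<^sub>1 * P + E\<close>, obtained by splitting the integral of
  \<open>t ^ k * (t - u) ^ m * (v - t) ^ n\<close> over \<open>[0, v]\<close> at \<open>u\<close>, have integer values and a small remainder \<open>E\<close>
  (a non-diagonal Pade approximation of powers of \<open>v / u\<close>, as in Beukers' work on fractional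
  parts of powers of rationals). If the parity of \<open>m\<close> is chosen according to the sign of
  \<open>D = v ^ N\<^sub>2 * X - u ^ N\<^sub>1 * Y\<close>, then \<open>P * X - (-1) ^ m * Y * Q\<close> is a nonzero integer, whence
  \<open>v ^ N\<^sub>2 \<le> P * \<bar>D\<bar> + Y * E\<close>. For \<open>k\<close> close to \<open>m + n\<close> both terms on the right tend
  to be too small for this as soon as \<open>16 * (v - u)\<^sup>2 < v\<close> and \<open>16 * D\<^sup>2 < v ^ N\<^sub>2 * X\<close>; the slack is thin
  for \<open>{u, v} = {16, 17}\<close>, and when both \<open>u\<close> and \<open>v\<close> are proper powers the exponents may be short,
  so these cases need additional information on the powers involved.
\<close>

section \<open>Pade approximation of powers\<close>

text \<open>The Beta integral on an arbitrary interval. Integration by parts trades a power of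
  \<open>r - t\<close> for a power of \<open>t - l\<close>, so the induction on \<open>b\<close>
  leaves \<open>a\<close> arbitrary.\<close>

lemma has_integral_beta_nat:
  fixes l r :: real
  assumes "l \<le> r"
  shows "((\<lambda>t. (t - l) ^ a * (r - t) ^ b) has_integral
           (r - l) ^ (a + b + 1) * (fact a * fact b / fact (a + b + 1))) {l..r}"
proof (induction b arbitrary: a)
  case 0
  have "((\<lambda>t. (t - l) ^ a) has_integral ((r - l) ^ (a + 1) / (a + 1) - (l - l) ^ (a + 1) / (a + 1))) {l..r}"
  proof (rule fundamental_theorem_of_calculus[OF assms])
    fix t assume "t \<in> {l..r}"
    have "((\<lambda>t. (t - l) ^ (a + 1) / (a + 1)) has_real_derivative (t - l) ^ a) (at t within {l..r})"
      by (rule derivative_eq_intros refl | simp)+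
    then show "((\<lambda>t. (t - l) ^ (a + 1) / (a + 1)) has_vector_derivative (t - l) ^ a) (at t within {l..r})"
      by (simp add: has_real_derivative_iff_has_vector_derivative)
  qed
  moreover have "(r - l) ^ (a + 1) / (a + 1) = (r - l) ^ (a + 1) * (fact a / fact (a + 1))"
    by (simp add: divide_simps)
  ultimately show ?case by simp
next
  case (Suc b)
  \<comment> \<open>The integrand is the derivative of
    \<open>(t - l) ^ (a + 1) * (r - t) ^ Suc b / (a + 1)\<close>, whose boundary values vanish;
    adding the induction hypothesis for \<open>Suc a\<close> cancels its second term.\<close>
  have "((\<lambda>t. (t - l) ^ a * (r - t) ^ Suc b - (b + 1) / (a + 1) * ((t - l) ^ Suc a * (r - t) ^ b)) has_integral
     ((r - l) ^ (a + 1) * (r - r) ^ Suc b / (a + 1) - (l - l) ^ (a + 1) * (r - l) ^ Suc b / (a + 1))) {l..r}"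
  proof (rule fundamental_theorem_of_calculus[OF assms])
    fix t assume "t \<in> {l..r}"
    have "((\<lambda>t. (t - l) ^ (a + 1) * (r - t) ^ Suc b / (a + 1)) has_real_derivative
        ((t - l) ^ a * (r - t) ^ Suc b - (b + 1) / (a + 1) * ((t - l) ^ Suc a * (r - t) ^ b))) (at t within {l..r})"
      by (rule derivative_eq_intros refl | simp)+ (simp add: field_simps)
    then show "((\<lambda>t. (t - l) ^ (a + 1) * (r - t) ^ Suc b / (a + 1)) has_vector_derivative
        ((t - l) ^ a * (r - t) ^ Suc b - (b + 1) / (a + 1) * ((t - l) ^ Suc a * (r - t) ^ b))) (at t within {l..r})"
      by (simp add: has_real_derivative_iff_has_vector_derivative)
  qed
  from has_integral_add[OF this has_integral_mult_right[OF Suc.IH[of "Suc a"], of "(b + 1) / (a + 1)"]]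
  have H: "((\<lambda>t. (t - l) ^ a * (r - t) ^ Suc b) has_integral
      (b + 1) / (a + 1) * ((r - l) ^ (Suc a + b + 1) * (fact (Suc a) * fact b / fact (Suc a + b + 1)))) {l..r}"
    by simp
  have eq: "(b + 1) / (a + 1) * ((r - l) ^ (Suc a + b + 1) * (fact (Suc a) * fact b / fact (Suc a + b + 1)))
     = (r - l) ^ (a + Suc b + 1) * (fact a * fact (Suc b) / fact (a + Suc b + 1))"
    by (simp add: fact_Suc del: of_nat_Suc)
  show ?case using H unfolding eq .
qed

text \<open>The coefficients are Beta values cleared by a common factor, hence natural numbers.
  \<open>e\<close> stands for \<open>v - u\<close>: in \<open>u\<close> and \<open>e\<close> the
  sums for \<open>pade_P\<close> and \<open>pade_E\<close> have nonnegative terms and can be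
  estimated termwise. Of the alternating \<open>pade_Q\<close> only the identity below and
  integrality matter.\<close>

definition pade_P :: "nat \<Rightarrow> nat \<Rightarrow> nat \<Rightarrow> 'a :: comm_semiring_1 \<Rightarrow> 'a \<Rightarrow> 'a" where
  "pade_P k m n u e = (\<Sum>j\<le>n. of_nat ((k + m + n + 1 choose j) * (m + n - j choose m)) * e ^ j * u ^ (n - j))"

definition pade_Q :: "nat \<Rightarrow> nat \<Rightarrow> nat \<Rightarrow> 'a :: comm_ring_1 \<Rightarrow> 'a \<Rightarrow> 'a" where
  "pade_Q k m n u v = (\<Sum>i\<le>m. of_nat ((k + i choose i) * (k + m + n + 1 choose (m - i))) * v ^ i * (- u) ^ (m - i))"

definition pade_E :: "nat \<Rightarrow> nat \<Rightarrow> nat \<Rightarrow> 'a :: comm_semiring_1 \<Rightarrow> 'a \<Rightarrow> 'a" where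
  "pade_E k m n u e = (\<Sum>j\<le>k. of_nat ((k + m + n + 1 choose (k - j)) * (m + j choose j)) * e ^ (m + n + 1 + j) * u ^ (k - j))"

text \<open>The integral of \<open>F\<close> over \<open>{0..v}\<close> is split at
  \<open>u\<close>. Each of the three integrals becomes a sum of Beta integrals by expanding the one
  factor that vanishes at neither end of its interval: \<open>(t - u) ^ m\<close> in powers of
  \<open>t\<close>, \<open>(v - t) ^ n\<close> in powers of \<open>u - t\<close>, and
  \<open>t ^ k\<close> in powers of \<open>t - u\<close>.\<close>

lemma pade_identity:
  fixes u v :: real
  assumes "0 \<le> u" "u \<le> v"
  shows "v ^ (k + n + 1) * pade_Q k m n u v
           = (-1) ^ m * u ^ (k + m + 1) * pade_P k m n u (v - u) + pade_E k m n u (v - u)"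
proof -
  define F where "F = (\<lambda>t::real. t ^ k * (t - u) ^ m * (v - t) ^ n)"
  \<comment> \<open>The factor that turns each Beta value, together with the binomial coefficient of
    its expansion, into a product of two binomial coefficients.\<close>
  define M :: real where "M = fact (k + m + n + 1) / (fact k * fact m * fact n)"
  have Mpos: "M > 0" by (simp add: M_def)
  have regroup: "A * w * (x * y * B) = x * (C * y * w) / M'" "A * w * (x * y * B) = x * (C * w * y) / M'"
    if "A * B = C / M'" for A B C M' w x y :: real
  proof -
    have "A * w * (x * y * B) = x * y * w * (A * B)" by simp
    then show "A * w * (x * y * B) = x * (C * y * w) / M'" "A * w * (x * y * B) = x * (C * w * y) / M'"
      by (simp_all add: that)
  qed
  have v0: "0 \<le> v" using assms by simp
  have "((\<lambda>t. \<Sum>i\<le>m. (real (m choose i) * (-u) ^ (m - i)) * ((t - 0) ^ (k + i) * (v - t) ^ n)) has_integral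
      (\<Sum>i\<le>m. (real (m choose i) * (-u) ^ (m - i)) *
       ((v - 0) ^ (k + i + n + 1) * (fact (k + i) * fact n / fact (k + i + n + 1))))) {0..v}"
    by (intro has_integral_sum has_integral_mult_right has_integral_beta_nat v0) simp
  moreover have "(\<Sum>i\<le>m. (real (m choose i) * (-u) ^ (m - i)) * ((t - 0) ^ (k + i) * (v - t) ^ n)) = F t" for t
  proof -
    have "(t - u) ^ m = (\<Sum>i\<le>m. real (m choose i) * t ^ i * (-u) ^ (m - i))"
      using binomial_ring[of t "-u" m] by simp
    then show ?thesis by (simp add: F_def sum_distrib_left sum_distrib_right power_add ac_simps)
  qed
  moreover have "(\<Sum>i\<le>m. (real (m choose i) * (-u) ^ (m - i)) *
       ((v - 0) ^ (k + i + n + 1) * (fact (k + i) * fact n / fact (k + i + n + 1))))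
     = v ^ (k + n + 1) * pade_Q k m n u v / M"
    unfolding pade_Q_def sum_distrib_left sum_divide_distrib
  proof (rule sum.cong[OF refl])
    fix i assume "i \<in> {..m}"
    then have i: "i \<le> m" by simp
    have 1: "real (m choose i) = fact m / (fact i * fact (m - i))" using i by (rule binomial_fact)
    have 2: "real (k + i choose i) = fact (k + i) / (fact i * fact k)" by (simp add: binomial_fact)
    have 3: "real (k + m + n + 1 choose (m - i)) = fact (k + m + n + 1) / (fact (m - i) * fact (k + i + n + 1))"
      using i by (subst binomial_fact) (auto simp: algebra_simps)
    have 4: "real (m choose i) * (fact (k + i) * fact n / fact (k + i + n + 1)) =
      real (k + i choose i) * real (k + m + n + 1 choose (m - i)) / M"
      unfolding 1 2 3 M_def by (simp add: field_simps del: fact_Suc)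
    have 5: "v ^ (k + i + n + 1) = v ^ (k + n + 1) * v ^ i" by (simp flip: power_add add: ac_simps)
    show "real (m choose i) * (- u) ^ (m - i) * ((v - 0) ^ (k + i + n + 1) * (fact (k + i) * fact n / fact (k + i + n + 1))) =
      v ^ (k + n + 1) * (of_nat ((k + i choose i) * (k + m + n + 1 choose (m - i))) * v ^ i * (- u) ^ (m - i)) / M"
      unfolding diff_0_right of_nat_mult 5 by (rule regroup(1)[OF 4])
  qed
  ultimately have A: "(F has_integral v ^ (k + n + 1) * pade_Q k m n u v / M) {0..v}" by simp
  have "((\<lambda>t. \<Sum>j\<le>n. ((-1) ^ m * real (n choose j) * (v - u) ^ j) * ((t - 0) ^ k * (u - t) ^ (m + n - j))) has_integral
      (\<Sum>j\<le>n. ((-1) ^ m * real (n choose j) * (v - u) ^ j) *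
       ((u - 0) ^ (k + (m + n - j) + 1) * (fact k * fact (m + n - j) / fact (k + (m + n - j) + 1))))) {0..u}"
    by (intro has_integral_sum has_integral_mult_right has_integral_beta_nat assms) simp
  moreover have "(\<Sum>j\<le>n. ((-1) ^ m * real (n choose j) * (v - u) ^ j) * ((t - 0) ^ k * (u - t) ^ (m + n - j))) = F t" for t
  proof -
    have "(v - t) ^ n = (\<Sum>j\<le>n. real (n choose j) * (v - u) ^ j * (u - t) ^ (n - j))"
      using binomial_ring[of "v - u" "u - t" n] by simp
    moreover have "(t - u) ^ m = (-1) ^ m * (u - t) ^ m"
      by (simp flip: power_mult_distrib)
    moreover have "(u - t) ^ (m + n - j) = (u - t) ^ m * (u - t) ^ (n - j)" if "j \<le> n" for j
      using that by (simp flip: power_add)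
    ultimately show ?thesis
      by (auto simp: F_def sum_distrib_left sum_distrib_right ac_simps intro!: sum.cong)
  qed
  moreover have "(\<Sum>j\<le>n. ((-1) ^ m * real (n choose j) * (v - u) ^ j) *
       ((u - 0) ^ (k + (m + n - j) + 1) * (fact k * fact (m + n - j) / fact (k + (m + n - j) + 1))))
     = (-1) ^ m * u ^ (k + m + 1) * pade_P k m n u (v - u) / M"
    unfolding pade_P_def sum_distrib_left sum_divide_distrib
  proof (rule sum.cong[OF refl])
    fix j assume "j \<in> {..n}"
    then have j: "j \<le> n" by simp
    have 1: "real (n choose j) = fact n / (fact j * fact (n - j))" using j by (rule binomial_fact)
    have 2: "real (m + n - j choose m) = fact (m + n - j) / (fact m * fact (n - j))"
      using j by (subst binomial_fact) auto
    have 3: "real (k + m + n + 1 choose j) = fact (k + m + n + 1) / (fact j * fact (k + (m + n - j) + 1))"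
    proof -
      have "k + m + n + 1 - j = k + (m + n - j) + 1" using j by simp
      moreover have "j \<le> k + m + n + 1" using j by simp
      ultimately show ?thesis by (simp only: binomial_fact)
    qed
    have 4: "real (n choose j) * (fact k * fact (m + n - j) / fact (k + (m + n - j) + 1)) =
      real (k + m + n + 1 choose j) * real (m + n - j choose m) / M"
      unfolding 1 2 3 M_def by (simp add: field_simps del: fact_Suc)
    have 5: "u ^ (k + (m + n - j) + 1) = u ^ (k + m + 1) * u ^ (n - j)"
    proof -
      have "k + (m + n - j) + 1 = k + m + 1 + (n - j)" using j by simp
      then show ?thesis by (simp only: power_add)
    qed
    show "(-1) ^ m * real (n choose j) * (v - u) ^ j * ((u - 0) ^ (k + (m + n - j) + 1) * (fact k * fact (m + n - j) / fact (k + (m + n - j) + 1))) =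
      (-1) ^ m * u ^ (k + m + 1) * (of_nat ((k + m + n + 1 choose j) * (m + n - j choose m)) * (v - u) ^ j * u ^ (n - j)) / M"
    proof -
      have "(-1) ^ m * real (n choose j) * (v - u) ^ j * c = real (n choose j) * (v - u) ^ j * ((-1) ^ m * c)" for c
        by simp
      then show ?thesis
        unfolding diff_0_right of_nat_mult 5
        using regroup(2)[OF 4, of "(v - u) ^ j" "(-1) ^ m * u ^ (k + m + 1)" "u ^ (n - j)"]
        by (simp only: mult.assoc)
    qed
  qed
  ultimately have B: "(F has_integral (-1) ^ m * u ^ (k + m + 1) * pade_P k m n u (v - u) / M) {0..u}" by simp
  have "((\<lambda>t. \<Sum>j\<le>k. (real (k choose j) * u ^ (k - j)) * ((t - u) ^ (m + j) * (v - t) ^ n)) has_integral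
      (\<Sum>j\<le>k. (real (k choose j) * u ^ (k - j)) *
       ((v - u) ^ (m + j + n + 1) * (fact (m + j) * fact n / fact (m + j + n + 1))))) {u..v}"
    by (intro has_integral_sum has_integral_mult_right has_integral_beta_nat assms) simp
  moreover have "(\<Sum>j\<le>k. (real (k choose j) * u ^ (k - j)) * ((t - u) ^ (m + j) * (v - t) ^ n)) = F t" for t
  proof -
    have "t ^ k = (\<Sum>j\<le>k. real (k choose j) * (t - u) ^ j * u ^ (k - j))"
      using binomial_ring[of "t - u" u k] by simp
    then show ?thesis by (simp add: F_def sum_distrib_left sum_distrib_right power_add ac_simps)
  qed
  moreover have "(\<Sum>j\<le>k. (real (k choose j) * u ^ (k - j)) *
       ((v - u) ^ (m + j + n + 1) * (fact (m + j) * fact n / fact (m + j + n + 1))))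
     = pade_E k m n u (v - u) / M"
    unfolding pade_E_def sum_distrib_left sum_divide_distrib
  proof (rule sum.cong[OF refl])
    fix j assume "j \<in> {..k}"
    then have j: "j \<le> k" by simp
    have 1: "real (k choose j) = fact k / (fact j * fact (k - j))" using j by (rule binomial_fact)
    have 2: "real (m + j choose j) = fact (m + j) / (fact j * fact m)" by (simp add: binomial_fact)
    have 3: "real (k + m + n + 1 choose (k - j)) = fact (k + m + n + 1) / (fact (k - j) * fact (m + j + n + 1))"
    proof -
      have "k + m + n + 1 - (k - j) = m + j + n + 1" using j by simp
      moreover have "k - j \<le> k + m + n + 1" using j by simp
      ultimately show ?thesis by (simp only: binomial_fact)
    qed
    have 4: "real (k choose j) * (fact (m + j) * fact n / fact (m + j + n + 1)) =
      real (k + m + n + 1 choose (k - j)) * real (m + j choose j) / M"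
      unfolding 1 2 3 M_def by (simp add: field_simps del: fact_Suc)
    show "real (k choose j) * u ^ (k - j) * ((v - u) ^ (m + j + n + 1) * (fact (m + j) * fact n / fact (m + j + n + 1))) =
      of_nat ((k + m + n + 1 choose (k - j)) * (m + j choose j)) * (v - u) ^ (m + n + 1 + j) * u ^ (k - j) / M"
    proof -
      have "(v - u) ^ (m + j + n + 1) = (v - u) ^ (m + n + 1 + j)" by (simp add: ac_simps)
      then show ?thesis
        using regroup(1)[OF 4, of "u ^ (k - j)" 1 "(v - u) ^ (m + n + 1 + j)"]
        by (simp only: of_nat_mult mult_1)
    qed
  qed
  ultimately have C: "(F has_integral pade_E k m n u (v - u) / M) {u..v}" by simp
  have "(F has_integral (-1) ^ m * u ^ (k + m + 1) * pade_P k m n u (v - u) / M + pade_E k m n u (v - u) / M) {0..v}"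
    by (rule has_integral_combine[OF assms B C])
  from has_integral_unique[OF A this] show ?thesis
    using Mpos by (simp add: field_simps)
qed

text \<open>By the identity, \<open>v ^ (k + n + 1)\<close> times the integer
  \<open>P * X - (-1) ^ m * Y * Q\<close> is, up to sign, \<open>P * \<bar>D\<bar> + Y * E\<close>.
  The sign condition makes the two parts add up instead of cancelling, so the integer is nonzero
  without a determinant argument, and at least 1 in absolute value.\<close>

lemma pade_small_value_gap:
  fixes u v X Y k m n :: nat
  defines "D \<equiv> int (v ^ (k + n + 1) * X) - int (u ^ (k + m + 1) * Y)"
  assumes "0 < u" "u \<le> v" and sgn: "(-1) ^ m * D < 0"
  shows "real v ^ (k + n + 1) \<le> pade_P k m n (real u) (real v - real u) * \<bar>D\<bar>
           + real Y * pade_E k m n (real u) (real v - real u)"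
proof -
  define P where "P = pade_P k m n (real u) (real v - real u)"
  define Q where "Q = pade_Q k m n (real u) (real v)"
  define E where "E = pade_E k m n (real u) (real v - real u)"
  define Z :: real where "Z = (-1) ^ m"
  have Z: "Z = 1 \<or> Z = -1" "Z * Z = 1"
    unfolding Z_def by (cases "even m"; simp)+
  have e: "0 \<le> real v - real u" using assms by simp
  have id: "real v ^ (k + n + 1) * Q = Z * real u ^ (k + m + 1) * P + E"
    unfolding P_def Q_def E_def Z_def using assms by (intro pade_identity) auto
  have "0 < real ((k + m + n + 1 choose 0) * (m + n - 0 choose m)) * (real v - real u) ^ 0 * real u ^ (n - 0)"
    using assms by simp
  also have "\<dots> \<le> P"
    unfolding P_def pade_P_def using e by (intro member_le_sum) auto
  finally have P0: "P > 0" .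
  have E0: "E \<ge> 0" unfolding E_def pade_E_def using e by (intro sum_nonneg) auto
  have D: "real_of_int D = real v ^ (k + n + 1) * X - real u ^ (k + m + 1) * Y"
    unfolding D_def by simp
  have ZD: "Z * real_of_int D < 0"
  proof -
    have "real_of_int ((-1) ^ m * D) < 0" using sgn by linarith
    then show ?thesis by (simp add: Z_def)
  qed
  then have ZD': "Z * real_of_int D = - \<bar>real_of_int D\<bar>" using Z(1) by auto
  have "P \<in> \<int>" "Q \<in> \<int>" "Z \<in> \<int>"
    unfolding P_def Q_def pade_P_def pade_Q_def Z_def by (intro Ints_sum Ints_mult Ints_power Ints_diff Ints_minus; simp)+
  then have int: "P * X - Z * Y * Q \<in> \<int>" by (intro Ints_diff Ints_mult) auto
  have "Z * (real v ^ (k + n + 1) * (P * X - Z * Y * Q))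
      = P * (Z * (real v ^ (k + n + 1) * X)) - (Z * Z) * Y * (real v ^ (k + n + 1) * Q)"
    by (simp add: algebra_simps)
  also have "\<dots> = P * (Z * D) - (Z * Z) * Y * E"
    unfolding id D Z(2) by (simp add: algebra_simps)
  finally have "Z * (real v ^ (k + n + 1) * (P * X - Z * Y * Q)) = P * (Z * D) - (Z * Z) * Y * E" .
  then have *: "Z * (real v ^ (k + n + 1) * (P * X - Z * Y * Q)) = - (P * \<bar>D\<bar> + Y * E)"
    using ZD' Z by (simp add: algebra_simps)
  have pos: "P * \<bar>D\<bar> + Y * E > 0"
    using P0 E0 ZD by (intro add_pos_nonneg mult_pos_pos mult_nonneg_nonneg) auto
  then have "P * X - Z * Y * Q \<noteq> 0" using * by auto
  then have "1 \<le> \<bar>P * X - Z * Y * Q\<bar>" using int Ints_nonzero_abs_ge1 by blast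
  then have "real v ^ (k + n + 1) \<le> real v ^ (k + n + 1) * \<bar>P * X - Z * Y * Q\<bar>"
    using mult_left_mono[of 1 "\<bar>P * X - Z * Y * Q\<bar>" "real v ^ (k + n + 1)"] by simp
  also have "\<dots> = \<bar>Z * (real v ^ (k + n + 1) * (P * X - Z * Y * Q))\<bar>"
    using Z(1) by (auto simp: abs_mult)
  also have "\<dots> = P * \<bar>D\<bar> + Y * E" unfolding * using pos by simp
  finally show ?thesis unfolding P_def E_def .
qed

section \<open>Bounds for the polynomial \<open>pade_P\<close> and the remainder
  \<open>pade_E\<close>\<close>

lemma binomial_drop_le:
  assumes "n \<le> m" "j \<le> n"
  shows "real (m + n - j choose m) \<le> real (m + n choose m) / 2 ^ j"
  using assms(2)
proof (induction j)
  case (Suc j)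
  define a where "a = m + n - Suc j"
  have a: "m + n - j = Suc a" using Suc.prems by (simp add: a_def)
  have am: "m \<le> a" "Suc a \<le> 2 * m" using Suc.prems assms by (auto simp: a_def)
  have "(Suc a - m) * (Suc a choose m) = Suc a * (a choose m)"
    using binomial_absorb_comp[of "Suc a" m] by simp
  then have "real (Suc a) * (a choose m) = real (Suc a - m) * (Suc a choose m)"
    by (metis of_nat_mult)
  \<comment> \<open>The quotient of \<open>a choose m\<close> by \<open>Suc a choose m\<close> is
    \<open>(Suc a - m) / Suc a\<close>, at most one half as long as
    \<open>Suc a \<le> 2 * m\<close>; this is what \<open>n \<le> m\<close> provides.\<close>
  also have "\<dots> \<le> (real (Suc a) / 2) * (Suc a choose m)"
    using am by (intro mult_right_mono) (auto simp: of_nat_diff)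
  finally have "real (Suc a) * (a choose m) \<le> real (Suc a) * ((Suc a choose m) / 2)" by simp
  then have "real (a choose m) \<le> (Suc a choose m) / 2"
    by (subst (asm) mult_le_cancel_left_pos) auto
  moreover have "real (Suc a choose m) \<le> real (m + n choose m) / 2 ^ j"
    using Suc a by simp
  ultimately show ?case unfolding a_def[symmetric] by simp
qed simp

text \<open>The halving from \<open>binomial_drop_le\<close> replaces \<open>e\<close> by
  \<open>e / 2\<close>, and the sum becomes a piece of the binomial expansion of
  \<open>(1 + e / (2 * u)) ^ (k + m + n + 1)\<close>.\<close>

lemma pade_P_le:
  fixes u e :: real
  assumes "0 < u" "0 \<le> e" "n \<le> m"
  shows "pade_P k m n u e \<le> 2 ^ (m + n) * u ^ n * (1 + e / (2 * u)) ^ (k + m + n + 1)"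
proof -
  define N where "N = k + m + n + 1"
  have "pade_P k m n u e \<le> (\<Sum>j\<le>n. 2 ^ (m + n) * u ^ n * (real (N choose j) * (e / (2 * u)) ^ j))"
    unfolding pade_P_def N_def[symmetric]
  proof (rule sum_mono)
    fix j assume "j \<in> {..n}"
    then have j: "j \<le> n" by simp
    have "real (m + n choose m) \<le> 2 ^ (m + n)"
      using binomial_le_pow2[of "m + n" m] by (metis of_nat_le_iff of_nat_numeral of_nat_power)
    then have "real (m + n choose m) / 2 ^ j \<le> 2 ^ (m + n) / 2 ^ j"
      by (simp add: divide_right_mono)
    with binomial_drop_le[OF assms(3) j]
    have "real (m + n - j choose m) \<le> 2 ^ (m + n) / 2 ^ j" by linarith
    then have "of_nat ((N choose j) * (m + n - j choose m)) * e ^ j * u ^ (n - j)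
       \<le> real (N choose j) * (2 ^ (m + n) / 2 ^ j) * e ^ j * u ^ (n - j)"
      using assms unfolding of_nat_mult by (intro mult_right_mono mult_left_mono) auto
    also have "\<dots> = 2 ^ (m + n) * u ^ n * (real (N choose j) * (e / (2 * u)) ^ j)"
      using assms j by (simp add: power_diff power_divide power_mult_distrib)
    finally show "of_nat ((N choose j) * (m + n - j choose m)) * e ^ j * u ^ (n - j)
       \<le> 2 ^ (m + n) * u ^ n * (real (N choose j) * (e / (2 * u)) ^ j)" .
  qed
  also have "\<dots> \<le> (\<Sum>j\<le>N. 2 ^ (m + n) * u ^ n * (real (N choose j) * (e / (2 * u)) ^ j))"
    using assms by (intro sum_mono2) (auto simp: N_def)
  also have "\<dots> = 2 ^ (m + n) * u ^ n * (1 + e / (2 * u)) ^ N"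
    using binomial_ring[of "e / (2 * u)" 1 N] by (simp add: sum_distrib_left[symmetric] add.commute)
  finally show ?thesis unfolding N_def .
qed

text \<open>From \<open>j\<close> to \<open>j + 1\<close> the coefficient is multiplied by
  \<open>(k - j) * (m + 1 + j) / ((m + n + 2 + j) * (j + 1))\<close>, at most
  \<open>\<kappa> / (j + 1)\<close>. So the terms are dominated by an exponential series, which
  \<open>pade_E_le\<close> sums.\<close>

lemma pade_E_coeff_le:
  fixes \<kappa> :: real
  assumes \<kappa>: "\<And>i. i < k \<Longrightarrow> real (k - i) * real (m + 1 + i) \<le> \<kappa> * real (m + n + 2 + i)" and "j \<le> k"
  shows "real ((k + m + n + 1 choose (k - j)) * (m + j choose j)) \<le> real (k + m + n + 1 choose k) * (\<kappa> ^ j / fact j)"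
  using assms(2)
proof (induction j)
  case (Suc j)
  define N where "N = k + m + n + 1"
  define a where "a = k - Suc j"
  have a: "k - j = Suc a" using Suc.prems by (simp add: a_def)
  have \<kappa>0: "0 \<le> \<kappa>"
  proof (rule ccontr)
    assume "\<not> 0 \<le> \<kappa>"
    then have "\<kappa> * real (m + n + 2 + 0) < 0" by (intro mult_neg_pos) auto
    moreover have "0 \<le> real (k - 0) * real (m + 1 + 0)" by simp
    ultimately show False using \<kappa>[of 0] Suc.prems by linarith
  qed
  have "Suc a * (N choose Suc a) = (N - a) * (N choose a)"
    by (metis binomial_absorb_comp binomial_absorption)
  moreover have "N - a = m + n + 2 + j" using Suc.prems by (simp add: N_def a_def)
  ultimately have 1: "real (N choose a) = real (k - j) * (N choose Suc a) / real (m + n + 2 + j)"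
    using a by (simp add: field_simps flip: of_nat_mult of_nat_add del: of_nat_Suc)
  have "Suc j * (Suc (m + j) choose Suc j) = Suc (m + j) * (m + j choose j)"
    by (rule Suc_times_binomial_eq[symmetric, of "m + j" j, simplified mult.commute[of _ "Suc j"]])
  then have 2: "real (m + Suc j choose Suc j) = real (m + 1 + j) * (m + j choose j) / real (Suc j)"
    by (simp add: field_simps flip: of_nat_mult of_nat_add of_nat_Suc)
  have "real ((N choose a) * (m + Suc j choose Suc j))
    = (real (k - j) * real (m + 1 + j)) / real (m + n + 2 + j) / real (Suc j) * real ((N choose (k - j)) * (m + j choose j))"
    unfolding of_nat_mult 1 2 a by simp
  also have "\<dots> \<le> \<kappa> / real (Suc j) * (real (N choose k) * (\<kappa> ^ j / fact j))"
  proof (rule mult_mono)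
    have "(real (k - j) * real (m + 1 + j)) / real (m + n + 2 + j) \<le> \<kappa>"
      using \<kappa>[of j] Suc.prems by (simp add: divide_le_eq)
    then show "(real (k - j) * real (m + 1 + j)) / real (m + n + 2 + j) / real (Suc j) \<le> \<kappa> / real (Suc j)"
      by (rule divide_right_mono) simp
  qed (use Suc \<kappa>0 in \<open>auto simp: N_def\<close>)
  also have "\<dots> = real (N choose k) * (\<kappa> ^ Suc j / fact (Suc j))" by simp
  finally show ?case unfolding N_def a_def .
qed simp

lemma pade_E_le:
  fixes u e \<kappa> :: real
  assumes "0 < u" "0 \<le> e" "0 \<le> \<kappa>"
    and \<kappa>: "\<And>i. i < k \<Longrightarrow> real (k - i) * real (m + 1 + i) \<le> \<kappa> * real (m + n + 2 + i)"
  shows "pade_E k m n u e \<le> real (k + m + n + 1 choose k) * e ^ (m + n + 1) * u ^ k * exp (\<kappa> * (e / u))"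
proof -
  define c where "c = real (k + m + n + 1 choose k) * e ^ (m + n + 1) * u ^ k"
  have c0: "0 \<le> c" using assms by (simp add: c_def)
  have "pade_E k m n u e \<le> (\<Sum>j\<le>k. c * ((\<kappa> * (e / u)) ^ j /\<^sub>R fact j))"
    unfolding pade_E_def
  proof (rule sum_mono)
    fix j assume "j \<in> {..k}"
    then have j: "j \<le> k" by simp
    have "of_nat ((k + m + n + 1 choose (k - j)) * (m + j choose j)) * e ^ (m + n + 1 + j) * u ^ (k - j)
      \<le> real (k + m + n + 1 choose k) * (\<kappa> ^ j / fact j) * e ^ (m + n + 1 + j) * u ^ (k - j)"
      using assms by (intro mult_right_mono pade_E_coeff_le[OF \<kappa> j]) auto
    also have "\<dots> = c * ((\<kappa> * (e / u)) ^ j /\<^sub>R fact j)"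
      using assms j by (simp add: c_def power_diff power_add power_mult_distrib power_divide field_simps)
    finally show "of_nat ((k + m + n + 1 choose (k - j)) * (m + j choose j)) * e ^ (m + n + 1 + j) * u ^ (k - j)
      \<le> c * ((\<kappa> * (e / u)) ^ j /\<^sub>R fact j)" .
  qed
  also have "\<dots> = c * (\<Sum>j\<le>k. (\<kappa> * (e / u)) ^ j /\<^sub>R fact j)" by (simp add: sum_distrib_left)
  also have "\<dots> \<le> c * exp (\<kappa> * (e / u))"
    unfolding exp_def using assms c0
    by (intro mult_left_mono sum_le_suminf summable_exp_generic) auto
  finally show ?thesis unfolding c_def .
qed

text \<open>Pascal's rule at most doubles a bound valid for all \<open>k\<close>. Starting from the
  central coefficient \<open>18 choose 9 = 48620\<close> improves the trivial bound
  \<open>2 ^ N\<close> by a factor above 5, a saving used for the remainder.\<close>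

lemma binomial_le_18:
  assumes "18 \<le> N"
  shows "real (N choose k) \<le> 2 ^ (N - 18) * 48620"
  using assms
proof (induction N arbitrary: k rule: dec_induct)
  case base
  have "18 choose k \<le> (18::nat) choose (18 div 2)" by (rule binomial_maximum)
  also have "\<dots> = 48620" by (simp add: binomial_fact' fact_numeral)
  finally show ?case by simp
next
  case (step n)
  show ?case
  proof (cases k)
    case k: (Suc j)
    have "real (Suc n choose k) = real (n choose j) + real (n choose Suc j)" unfolding k by simp
    also have "\<dots> \<le> 2 ^ (n - 18) * 48620 + 2 ^ (n - 18) * 48620" by (intro add_mono step.IH)
    also have "\<dots> = 2 ^ Suc (n - 18) * 48620" by simp
    also have "Suc (n - 18) = Suc n - 18" using step by simp
    finally show ?thesis .
  next
    case 0
    have "(1::real) * 1 \<le> 2 ^ (Suc n - 18) * 48620" by (intro mult_mono) auto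
    then show ?thesis using 0 by simp
  qed
qed

section \<open>Contradiction from logarithmic estimates\<close>

lemma ln_one_plus_ge_quadratic:
  fixes x :: real
  assumes "0 \<le> x"
  shows "x - x\<^sup>2 / 2 \<le> ln (1 + x)"
proof -
  have "(\<lambda>x::real. ln (1 + x) - x + x\<^sup>2 / 2) 0 \<le> (\<lambda>x. ln (1 + x) - x + x\<^sup>2 / 2) x"
  proof (rule DERIV_nonneg_imp_nondecreasing[OF assms])
    fix t :: real assume t: "0 \<le> t" "t \<le> x"
    have "((\<lambda>x. ln (1 + x) - x + x\<^sup>2 / 2) has_real_derivative t\<^sup>2 / (1 + t)) (at t)"
      using t by (auto intro!: derivative_eq_intros simp: field_simps power2_eq_square)
    then show "\<exists>y. ((\<lambda>x. ln (1 + x) - x + x\<^sup>2 / 2) has_real_derivative y) (at t) \<and> 0 \<le> y"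
      using t by (intro exI[of _ "t\<^sup>2 / (1 + t)"] conjI) simp_all
  qed
  then show ?thesis by simp
qed

text \<open>The gap inequality multiplied by \<open>X\<close> and divided by \<open>Tv\<close>, in
  logarithms: \<open>f1\<close> bounds the term with the distance of \<open>Tu\<close> and
  \<open>Tv\<close>, \<open>f2\<close> the term with the remainder. Sizes are measured by the mean
  logarithm \<open>W\<close>; \<open>d\<close> and \<open>L\<close> record the asymmetry of the
  degrees and of \<open>u\<close>, \<open>v\<close>, and \<open>\<eta>\<close> pays for exchanging
  \<open>Tu\<close> and \<open>Tv\<close>.\<close>

lemma pade_log_contradiction:
  fixes u v X Y k m n :: nat and \<eta> f1 f2 :: real
  defines "Tv \<equiv> v ^ (k + n + 1) * X" and "Tu \<equiv> u ^ (k + m + 1) * Y"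
  defines "\<mu> \<equiv> real m + real n" and "d \<equiv> (real m - real n) / 2"
  defines "x \<equiv> (real v - real u) / real u" and "L \<equiv> ln (real v) - ln (real u)"
  defines "W \<equiv> (ln (real u) + ln (real v)) / 2"
  assumes uv: "0 < u" "u < v" and XY: "0 < X" "0 < Y" and mn: "n \<le> m"
    and sgn: "(-1) ^ m * (int Tv - int Tu) < 0"
    and close: "16 * (real Tv - real Tu)\<^sup>2 < max (real Tv) (real Tu)"
    and \<eta>: "\<bar>ln (real Tu) - ln (real Tv)\<bar> \<le> \<eta>"
    and k: "k \<le> m + n + 4" "18 \<le> k + m + n + 1"
    and f1: "(ln (real X) + ln (real Y) - 2 * W) / 4 + \<mu> * ln 2 + (\<mu> / 4 - real k / 2) * W
        + 3/4 * d * L + (real k + \<mu> + 1) * x\<^sup>2 / 8 - 2 * ln 2 + 3/2 * \<eta> \<le> f1"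
    and f2: "(ln (real X) + ln (real Y) - 2 * W) / 2 + L / 2 + (real k + \<mu> + 1) * ln 2 + ln (48620 / 2 ^ 18)
        + (\<mu> + 1) * ln (real v - real u) - \<mu> / 2 * W + (real k + 1) * x\<^sup>2 / 4 + 5/2 * d * x + \<eta> / 2 \<le> f2"
    and f12: "exp f1 + exp f2 < 1"
  shows False
proof -
  define U where "U = ln (real u)"
  define e where "e = real v - real u"
  have e1: "1 \<le> e" using uv by (simp add: e_def)
  have x0: "0 < x" using uv by (simp add: x_def)
  have T0: "0 < real Tv" "0 < real Tu" using uv XY by (simp_all add: Tv_def Tu_def)
  have vx: "real v = real u * (1 + x)" using uv by (simp add: x_def field_simps)
  have L: "L = ln (1 + x)" unfolding L_def vx using uv x0 by (simp add: ln_mult)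
  have L0: "0 < L" using uv by (simp add: L_def)
  have d0: "0 \<le> d" using mn by (simp add: d_def)
  have xL: "x - L \<le> x\<^sup>2 / 2"
    using ln_one_plus_ge_quadratic[of x] x0 unfolding L by simp
  have tu: "ln (real Tu) = (real k + \<mu> / 2 + d + 1) * U + ln (real Y)"
    using uv XY by (simp add: Tu_def ln_mult ln_realpow U_def \<mu>_def d_def field_simps)
  have tv: "ln (real Tv) = (real k + \<mu> / 2 - d + 1) * (U + L) + ln (real X)"
    using uv XY by (simp add: Tv_def ln_mult ln_realpow U_def L_def \<mu>_def d_def field_simps)
  have D0: "real Tv - real Tu \<noteq> 0"
    using sgn by (auto simp: of_nat_eq_iff)
  define P where "P = pade_P k m n (real u) e"
  define E where "E = pade_E k m n (real u) e"
  have gap: "real v ^ (k + n + 1) \<le> P * \<bar>real Tv - real Tu\<bar> + real Y * E"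
    using pade_small_value_gap[of u v m k n X Y] uv sgn unfolding P_def E_def e_def Tv_def Tu_def by simp
  have "real Tv \<le> real X * (P * \<bar>real Tv - real Tu\<bar>) + real X * (real Y * E)"
    using mult_left_mono[OF gap, of "real X"] by (simp add: Tv_def algebra_simps)
  moreover have "real X * (P * \<bar>real Tv - real Tu\<bar>) \<le> real Tv * exp f1"
  proof -
    define B where "B = 2 ^ (m + n) * real u ^ n * (1 + x / 2) ^ (k + m + n + 1)"
    have B0: "0 < B" using uv x0 by (auto simp: B_def intro!: mult_pos_pos)
    have "P \<le> B"
      using pade_P_le[of "real u" e n m k] uv mn e1
      unfolding P_def B_def x_def e_def by (simp add: mult.commute)
    then have 1: "real X * (P * \<bar>real Tv - real Tu\<bar>) \<le> real X * (B * \<bar>real Tv - real Tu\<bar>)"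
      by (intro mult_left_mono mult_right_mono) auto
    have lnB: "ln B = \<mu> * ln 2 + (\<mu> / 2 - d) * U + (real k + \<mu> + 1) * ln (1 + x / 2)"
    proof -
      have "ln B = real (m + n) * ln 2 + real n * ln (real u) + real (k + m + n + 1) * ln (1 + x / 2)"
      proof -
        have "ln (a * b * c) = ln a + ln b + ln c" if "0 < a" "0 < b" "0 < c" for a b c :: real
          using that by (simp add: ln_mult)
        then have "ln B = ln (2 ^ (m + n)) + ln (real u ^ n) + ln ((1 + x / 2) ^ (k + m + n + 1))"
          unfolding B_def using uv x0 by simp
        then show ?thesis using uv x0 by (simp only: ln_realpow)
      qed
      then show ?thesis by (simp add: U_def \<mu>_def d_def algebra_simps add_divide_distrib diff_divide_distrib)
    qed
    \<comment> \<open>Logarithmic form of the closeness: the distance is less than a quarter of the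
      square root of the larger number. That quarter is the source of the gain
      \<open>2 * ln 2\<close> in the first exponent.\<close>
    have "ln (16 * (real Tv - real Tu)\<^sup>2) \<le> ln (max (real Tv) (real Tu))"
      using close D0 T0 by (subst ln_le_cancel_iff) auto
    moreover have "ln (16 * (real Tv - real Tu)\<^sup>2) = 4 * ln 2 + 2 * ln \<bar>real Tv - real Tu\<bar>"
    proof -
      have "ln (16::real) = 4 * ln 2" using ln_realpow[of 2 4] by simp
      moreover have "(real Tv - real Tu)\<^sup>2 = \<bar>real Tv - real Tu\<bar>\<^sup>2" by simp
      then have "ln ((real Tv - real Tu)\<^sup>2) = 2 * ln \<bar>real Tv - real Tu\<bar>"
        using D0 by (metis ln_realpow of_nat_numeral zero_less_abs_iff)
      ultimately show ?thesis using D0 by (simp add: ln_mult)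
    qed
    moreover have "ln (max (real Tv) (real Tu)) \<le> (ln (real Tu) + ln (real Tv)) / 2 + \<eta> / 2"
    proof -
      have "ln (max (real Tv) (real Tu)) = ln (real Tu) \<or> ln (max (real Tv) (real Tu)) = ln (real Tv)"
        by (auto simp: max_def)
      then show ?thesis using \<eta> by argo
    qed
    ultimately have lnD: "ln \<bar>real Tv - real Tu\<bar> \<le> (ln (real Tu) + ln (real Tv)) / 4 + \<eta> / 4 - 2 * ln 2"
      by linarith
    \<comment> \<open>Up to second order \<open>1 + x / 2\<close> is the square root of
      \<open>1 + x = v / u\<close>, so powers of it are shared evenly between \<open>u\<close> and
      \<open>v\<close>.\<close>
    have sq: "ln (1 + x / 2) \<le> L / 2 + x\<^sup>2 / 8"
    proof -
      have "(1 + x / 2)\<^sup>2 \<le> (1 + x) * (1 + x\<^sup>2 / 4)"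
        using x0 by (simp add: power2_eq_square algebra_simps)
      then have "ln ((1 + x / 2)\<^sup>2) \<le> ln ((1 + x) * (1 + x\<^sup>2 / 4))"
        using x0 by (subst ln_le_cancel_iff) (auto intro!: mult_pos_pos add_pos_nonneg)
      also have "\<dots> = L + ln (1 + x\<^sup>2 / 4)"
        unfolding L using x0 by (intro ln_mult_pos) (auto simp: add_pos_nonneg)
      also have "ln (1 + x\<^sup>2 / 4) \<le> x\<^sup>2 / 4" by (intro ln_add_one_self_le_self) simp
      finally show ?thesis using x0 by (simp add: ln_realpow)
    qed
    have sq': "(real k + \<mu> + 1) * ln (1 + x / 2) \<le> (real k + \<mu> + 1) * (L / 2 + x\<^sup>2 / 8)"
      using sq by (intro mult_left_mono) (auto simp: \<mu>_def)
    have "ln (real X * (B * \<bar>real Tv - real Tu\<bar>)) = ln (real X) + ln B + ln \<bar>real Tv - real Tu\<bar>"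
      using XY B0 D0 by (simp add: ln_mult)
    also have "\<dots> \<le> ln (real Tv) + f1"
    proof -
      have W: "W = U + L / 2" by (simp add: W_def U_def L_def field_simps)
      have \<eta>': "ln (real Tu) - ln (real Tv) \<le> \<eta>" "ln (real Tv) - ln (real Tu) \<le> \<eta>" using \<eta> by auto
      note h = f1[unfolded W] lnD sq' \<eta>'[unfolded tu tv]
      show ?thesis using h unfolding lnB tu tv by (simp add: algebra_simps) (simp add: field_simps)
    qed
    finally have "ln (real X * (B * \<bar>real Tv - real Tu\<bar>)) \<le> ln (real Tv * exp f1)"
      using T0 by (simp add: ln_mult)
    then have "real X * (B * \<bar>real Tv - real Tu\<bar>) \<le> real Tv * exp f1"
      using T0 XY B0 D0 by (subst (asm) ln_le_cancel_iff) auto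
    with 1 show ?thesis by linarith
  qed
  moreover have "real X * (real Y * E) \<le> real Tv * exp f2"
  proof -
    define \<kappa> where "\<kappa> = (real k + 1) / 2 + 2 * d"
    define B where "B = 2 ^ (k + m + n + 1 - 18) * 48620 * e ^ (m + n + 1) * real u ^ k * exp (\<kappa> * x)"
    have B0: "0 < B" using uv e1 by (auto simp: B_def intro!: mult_pos_pos)
    \<comment> \<open>Twice the factor \<open>m + 1 + i\<close> is \<open>c + 2 * i'\<close> plus
      \<open>D\<close>. The first part leads to \<open>(k + 1) / 2\<close>, using that
      \<open>k\<close> exceeds \<open>c\<close> by at most 2; the second leads to
      \<open>D = 2 * d\<close>.\<close>
    have \<kappa>: "real (k - i) * real (m + 1 + i) \<le> \<kappa> * real (m + n + 2 + i)" if "i < k" for i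
    proof -
      define c i' k' D where "c = real m + real n + 2" and "i' = real i" and "k' = real k" and "D = real m - real n"
      have h: "0 \<le> i'" "i' \<le> k'" "k' \<le> c + 2" "2 \<le> c" "0 \<le> D"
        using that k(1) mn by (auto simp: c_def i'_def k'_def D_def)
      have "i' * (k' - c) \<le> i' * 2" using h by (intro mult_left_mono) auto
      moreover have "0 \<le> (i' - 1)\<^sup>2" by simp
      ultimately have 1: "(k' - i') * (c + 2 * i') \<le> (k' + 1) * (c + i')"
        using h by (simp add: algebra_simps power2_eq_square)
      have 2: "(k' - i') * D \<le> (2 * (c + i')) * D" using h by (intro mult_right_mono) auto
      have "real (k - i) * real (m + 1 + i) = (k' - i') * (c + 2 * i') / 2 + (k' - i') * D / 2"
        using that by (simp add: of_nat_diff c_def i'_def k'_def D_def field_simps)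
      also have "\<dots> \<le> (k' + 1) * (c + i') / 2 + D * (c + i')" using 1 2 by (simp add: field_simps)
      also have "\<dots> = \<kappa> * real (m + n + 2 + i)"
        by (simp add: \<kappa>_def c_def i'_def k'_def D_def d_def field_simps)
      finally show ?thesis .
    qed
    have "E \<le> real (k + m + n + 1 choose k) * e ^ (m + n + 1) * real u ^ k * exp (\<kappa> * x)"
      unfolding E_def x_def e_def[symmetric]
      by (rule pade_E_le) (use uv e1 \<kappa> d0 in \<open>auto simp: \<kappa>_def\<close>)
    also have "\<dots> \<le> B"
      unfolding B_def using binomial_le_18[OF k(2), of k] e1 by (intro mult_right_mono) auto
    finally have 1: "real X * (real Y * E) \<le> real X * (real Y * B)"
      by (intro mult_left_mono) auto
    have lnB: "ln B = (real k + \<mu> + 1) * ln 2 + ln (48620 / 2 ^ 18) + (\<mu> + 1) * ln e + real k * U + \<kappa> * x"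
    proof -
      have "ln B = (real k + \<mu> + 1 - 18) * ln 2 + ln 48620 + (\<mu> + 1) * ln e + real k * U + \<kappa> * x"
        unfolding B_def using uv e1 k(2)
        by (simp add: ln_mult ln_realpow U_def \<mu>_def of_nat_diff algebra_simps)
      moreover have "ln (48620 / 2 ^ 18 :: real) = ln 48620 - 18 * ln 2"
      proof -
        have "ln (48620 / 2 ^ 18 :: real) = ln 48620 - ln (2 ^ 18)" by (rule ln_divide_pos) simp_all
        then show ?thesis using ln_realpow[of 2 18] by simp
      qed
      ultimately show ?thesis by (simp add: algebra_simps)
    qed
    have "ln (real X * (real Y * B)) = ln (real X) + ln (real Y) + ln B"
      using XY B0 by (simp add: ln_mult)
    also have "\<dots> \<le> ln (real Tv) + f2"
    proof -
      have W: "W = U + L / 2" by (simp add: W_def U_def L_def field_simps)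
      have \<eta>': "ln (real Tu) - ln (real Tv) \<le> \<eta>" "ln (real Tv) - ln (real Tu) \<le> \<eta>" using \<eta> by auto
      have h1: "(real k + 1) * (x - L) \<le> (real k + 1) * (x\<^sup>2 / 2)" using xL by (intro mult_left_mono) auto
      have h2: "d * L \<le> d * x" using d0 ln_add_one_self_le_self[of x] x0 unfolding L by (intro mult_left_mono) auto
      note h = f2[unfolded W e_def[symmetric]] \<eta>'[unfolded tu tv] h1 h2
      show ?thesis using h unfolding lnB tv \<kappa>_def by (simp add: algebra_simps) (simp add: field_simps)
    qed
    finally have "ln (real X * (real Y * B)) \<le> ln (real Tv * exp f2)"
      using T0 by (simp add: ln_mult)
    then have "real X * (real Y * B) \<le> real Tv * exp f2"
      using T0 XY B0 by (subst (asm) ln_le_cancel_iff) auto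
    with 1 show ?thesis by linarith
  qed
  ultimately have "real Tv \<le> real Tv * (exp f1 + exp f2)" by (simp add: algebra_simps)
  then show False using f12 T0 by (simp add: mult_le_cancel_left1)
qed

lemma ln2_bounds: "693 / 1000 \<le> ln (2::real)" "ln (2::real) \<le> 6932 / 10000"
  using ln_approx_bounds[of 2 3] by (simp_all add: eval_nat_numeral)

lemma ln_binomial_18: "ln (48620 / 2 ^ 18 :: real) \<le> - (168 / 100)"
proof -
  have "ln ((2::real) ^ 17) \<le> ln ((2 ^ 18 / 48620) ^ 7)" by (subst ln_le_cancel_iff) (simp_all add: power_divide)
  then have "17 * ln 2 \<le> 7 * ln (2 ^ 18 / 48620 :: real)" by (simp only: ln_realpow of_nat_numeral)
  moreover have "ln (2 ^ 18 / 48620 :: real) = - ln (48620 / 2 ^ 18)" by (simp add: ln_div)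
  ultimately show ?thesis using ln2_bounds(1) by linarith
qed

text \<open>Six consecutive integers contain two consecutive multiples of 3, and their thirds have
  opposite parity. In the application \<open>c\<close> is \<open>N1 - 1\<close>, so that
  \<open>c - k\<close> is the degree \<open>m\<close>.\<close>

lemma ex_index_with_parity:
  fixes S J :: int and odd_wanted :: bool and c :: nat
  assumes "0 \<le> S + J"
  shows "\<exists>k::nat. S + J \<le> 3 * int k \<and> 3 * int k \<le> S + J + 5 \<and> (odd (int c - int k) \<longleftrightarrow> odd_wanted)"
proof -
  define k0 where "k0 = nat ((S + J + 2) div 3)"
  have k0: "S + J \<le> 3 * int k0" "3 * int k0 \<le> S + J + 2" using assms by (auto simp: k0_def)
  show ?thesis
  proof (cases "odd (int c - int k0) \<longleftrightarrow> odd_wanted")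
    case True
    then show ?thesis using k0 by (intro exI[of _ k0]) auto
  next
    case False
    then have "odd (int c - int (Suc k0)) \<longleftrightarrow> odd_wanted" by auto
    then show ?thesis using k0 by (intro exI[of _ "Suc k0"]) auto
  qed
qed

text \<open>The free parameter \<open>J\<close> steers the degrees: \<open>k\<close> is taken with \<open>J \<le> 3 * k - S \<le> J + 5\<close>, six consecutive
  values being needed to prescribe the parity of \<open>m\<close>. Small \<open>J\<close> favours the remainder term (bounded by
  \<open>exp f2\<close>), large \<open>J\<close> the term with the given distance (bounded by \<open>exp f1\<close>).\<close>

lemma power_pair_contradiction:
  fixes u v X Y N1 N2 :: nat and J :: int and f1 f2 \<eta> S e x W \<Delta> :: real
  defines "Tv \<equiv> v ^ N2 * X" and "Tu \<equiv> u ^ N1 * Y"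
  defines "S \<equiv> real N1 + real N2 - 2" and "e \<equiv> real v - real u"
  defines "x \<equiv> (real v - real u) / real u" and "W \<equiv> (ln (real u) + ln (real v)) / 2"
  defines "\<Delta> \<equiv> W - 4 * ln 2 - 2 * ln e"
  assumes uv: "16 \<le> u" "u < v" and x16: "x \<le> 1 / 16" and XY: "0 < X" "X \<le> v" "0 < Y" and N: "N2 \<le> N1"
    and neq: "Tu \<noteq> Tv"
    and close: "16 * (real Tv - real Tu)\<^sup>2 < max (real Tv) (real Tu)"
    and \<eta>: "\<bar>ln (real Tu) - ln (real Tv)\<bar> \<le> \<eta>" "\<eta> \<le> 6 / 100"
    and S: "28 \<le> S" and J: "J \<le> -1" "- S / 5 \<le> real_of_int J"
    and We: "2 * ln e + ln 2 \<le> W"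
    and f1: "(ln (real X) + ln (real Y) - 2 * W) / 4 - (S + 4 * J) / 12 * (W - 4 * ln 2) - 2 * (J + 1) * ln 2
        + 16/100 * S * x\<^sup>2 + x + 1/10 \<le> f1"
    and f2: "(ln (real X) + ln (real Y) - 2 * W) / 2 + ln e + (J + 6) * ln 2 - 168/100
        - (S - 2 * J - 10) / 6 * \<Delta> + 33/100 * S * x\<^sup>2 + 2 * x + 4/100 \<le> f2"
    and f12: "exp f1 + exp f2 < 1"
  shows False
proof -
  define U where "U = ln (real u)"
  define L where "L = ln (real v) - ln (real u)"
  have x0: "0 < x" using uv by (simp add: x_def)
  have vx: "real v = real u * (1 + x)" using uv by (simp add: x_def field_simps)
  have L: "L = ln (1 + x)" unfolding L_def vx using uv x0 by (simp add: ln_mult)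
  have L0: "0 < L" "L \<le> x" using uv ln_add_one_self_le_self[of x] x0 by (simp_all add: L_def L[unfolded L_def])
  have U: "277 / 100 \<le> U"
  proof -
    have "ln (2 ^ 4) \<le> U" unfolding U_def using uv by (subst ln_le_cancel_iff) auto
    then show ?thesis using ln2_bounds unfolding ln_realpow by simp
  qed
  define d where "d = (real N1 - real N2) / 2"
  have d0: "0 \<le> d" using N by (simp add: d_def)
  have tu: "ln (real Tu) = real N1 * U + ln (real Y)"
    using uv XY by (simp add: Tu_def ln_mult ln_realpow U_def)
  have tv: "ln (real Tv) = real N2 * (U + L) + ln (real X)"
    using uv XY by (simp add: Tv_def ln_mult ln_realpow U_def L_def)
  have lX: "0 \<le> ln (real X)" "ln (real X) \<le> U + L" using XY uv by (auto simp: U_def L_def)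
  have lY: "0 \<le> ln (real Y)" using XY by auto
  have N2L: "real N2 * L \<le> real N2 * x" using L0 by (intro mult_left_mono) auto
  have dU: "2 * d * U \<le> real N2 * x + U + x + 6/100"
    using \<eta> N2L lX lY L0 unfolding tu tv d_def by (simp add: algebra_simps abs_le_iff)
  \<comment> \<open>The excess of \<open>N1\<close> over \<open>N2\<close> only has to compensate
    \<open>N2 * L\<close> and the cofactors. The constants come from division by
    \<open>U \<ge> 277 / 100\<close>: \<open>3611 / 10000\<close> lies just above
    \<open>100 / 277\<close>.\<close>
  have d_le: "d \<le> real N2 * x * (18055/100000) + 523/1000"
  proof -
    have "2 * d * U \<le> (real N2 * x * (3611/10000) + 1046/1000) * U"
    proof -
      have "1 \<le> 3611/10000 * U" "x + 6/100 \<le> 46/1000 * U" using U x16 by auto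
      moreover have "real N2 * x * 1 \<le> real N2 * x * (3611/10000 * U)"
        using calculation x0 by (intro mult_left_mono) auto
      ultimately show ?thesis using dU by (simp add: algebra_simps)
    qed
    then have "2 * d \<le> real N2 * x * (3611/10000) + 1046/1000" using U by (subst (asm) mult_le_cancel_right_pos) auto
    then show ?thesis by simp
  qed
  have S': "S = real N2 * 2 + 2 * d - 2" by (simp add: S_def d_def field_simps)
  have N2x: "real N2 * x \<le> real N2 / 16" using x16 mult_left_mono[of x "1/16" "real N2"] by simp
  have N2: "14 \<le> N2" using S' S d_le N2x by linarith
  have SJ: "0 \<le> (int N1 + int N2 - 2) + J"
  proof -
    have "0 \<le> S + real_of_int J" using S J by simp
    then have "0 \<le> real_of_int ((int N1 + int N2 - 2) + J)" by (simp add: S_def)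
    then show ?thesis by linarith
  qed
  \<comment> \<open>\<open>m\<close> will be \<open>N1 - 1 - k\<close>; it has to be odd exactly
    when \<open>Tv - Tu\<close> is positive.\<close>
  obtain k :: nat where k: "(int N1 + int N2 - 2) + J \<le> 3 * int k" "3 * int k \<le> (int N1 + int N2 - 2) + J + 5"
    and par: "odd (int (N1 - 1) - int k) \<longleftrightarrow> Tu < Tv"
    using ex_index_with_parity[OF SJ] by metis
  \<comment> \<open>Ensures that \<open>n = N2 - 1 - k\<close> is not truncated; \<open>k\<close> is
    at most about \<open>S / 3\<close>, whereas \<open>N2\<close> is close to
    \<open>S / 2\<close>.\<close>
  have kN: "k + 1 \<le> N2"
  proof -
    have "real (3 * k) \<le> S + 4" using k(2) J(1) unfolding S_def by linarith
    then have "3 * real k + 3 \<le> 2 * real N2 + 2 * d + 5" using S' by simp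
    also have "\<dots> < 3 * real N2 + 3" using d_le N2x N2 by linarith
    finally show ?thesis by linarith
  qed
  define m where "m = N1 - 1 - k"
  define n where "n = N2 - 1 - k"
  have N1m: "N1 = k + m + 1" and N2n: "N2 = k + n + 1" and nm: "n \<le> m"
    using kN N by (auto simp: m_def n_def)
  have "odd (int m) \<longleftrightarrow> Tu < Tv" using par kN N by (simp add: m_def of_nat_diff)
  then have sgn: "(-1) ^ m * (int Tv - int Tu) < 0" using neq by (cases "even m") auto
  define \<mu> where "\<mu> = real m + real n"
  \<comment> \<open>As \<open>S = 2 * k + \<mu>\<close>, this is \<open>k - (m + n)\<close>, the
    deviation from the balanced degrees; it is known up to 5.\<close>
  define j where "j = 3 * real k - S"
  have j: "real_of_int J \<le> j" "j \<le> real_of_int J + 5"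
    using k unfolding j_def S_def by linarith+
  have S2: "S = 2 * real k + \<mu>" by (simp add: S_def \<mu>_def N1m N2n)
  have k_eq: "real k = (S + j) / 3" and \<mu>_eq: "\<mu> = (S - 2 * j) / 3"
    using S2 by (simp_all add: j_def)
  have d_eq: "(real m - real n) / 2 = d" by (simp add: d_def N1m N2n)
  have J': "real_of_int J \<le> -1" using J(1) by linarith
  have W: "W = U + L / 2" by (simp add: W_def U_def L_def field_simps)
  have dx: "d * x \<le> 903/10000 * S * x\<^sup>2 + 535/1000 * x"
  proof -
    have "d * x \<le> (real N2 * x * (18055/100000) + 523/1000) * x"
      using d_le x0 by (intro mult_right_mono) auto
    also have "real N2 * x * (18055/100000) \<le> ((S + 2) / 2) * x * (18055/100000)"
      using S' d0 x0 by (intro mult_right_mono) auto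
    also have "(((S + 2) / 2) * x * (18055/100000) + 523/1000) * x = (18055/200000) * S * x\<^sup>2 + (18055/100000) * x * x + 523/1000 * x"
      by (simp add: algebra_simps power2_eq_square)
    also have "(18055/100000) * x * x \<le> (18055/100000) * x * (1/16)" using x16 x0 by (intro mult_left_mono) auto
    also have "(18055/200000) * S * x\<^sup>2 \<le> 903/10000 * S * x\<^sup>2" using S by (intro mult_right_mono) auto
    finally show ?thesis using x0 by simp
  qed
  have dL: "d * L \<le> d * x" using d0 L0 by (intro mult_left_mono) auto
  have xx: "x\<^sup>2 \<le> x / 16" using mult_left_mono[OF x16, of x] x0 by (simp add: power2_eq_square)
  show False
  proof (rule pade_log_contradiction[of u v X Y n m k \<eta> f1 f2])
    show "0 < u" "u < v" "0 < X" "0 < Y" "n \<le> m" using uv XY nm by auto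
    show "(-1) ^ m * (int (v ^ (k + n + 1) * X) - int (u ^ (k + m + 1) * Y)) < 0"
      using sgn unfolding Tu_def Tv_def N1m N2n .
    show "16 * (real (v ^ (k + n + 1) * X) - real (u ^ (k + m + 1) * Y))\<^sup>2
        < max (real (v ^ (k + n + 1) * X)) (real (u ^ (k + m + 1) * Y))"
      using close unfolding Tu_def Tv_def N1m N2n .
    show "\<bar>ln (real (u ^ (k + m + 1) * Y)) - ln (real (v ^ (k + n + 1) * X))\<bar> \<le> \<eta>"
      using \<eta> unfolding Tu_def Tv_def N1m N2n by simp
    have "real k \<le> \<mu> + 4" using j J' S2 unfolding j_def by linarith
    then show "k \<le> m + n + 4" unfolding \<mu>_def by linarith
    have "3 * real k = S + j" unfolding j_def by simp
    then have "18 < S - real k + 2" using j(2) J' S by linarith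
    then show "18 \<le> k + m + n + 1" using S2 unfolding \<mu>_def by linarith
    show "exp f1 + exp f2 < 1" by fact
    show "(ln (real X) + ln (real Y) - 2 * ((ln (real u) + ln (real v)) / 2)) / 4 + (real m + real n) * ln 2
      + ((real m + real n) / 4 - real k / 2) * ((ln (real u) + ln (real v)) / 2)
      + 3 / 4 * ((real m - real n) / 2) * (ln (real v) - ln (real u))
      + (real k + (real m + real n) + 1) * ((real v - real u) / real u)\<^sup>2 / 8 - 2 * ln 2 + 3 / 2 * \<eta> \<le> f1"
      unfolding \<mu>_def[symmetric] W_def[symmetric] d_eq L_def[symmetric] x_def[symmetric]
    proof -
      \<comment> \<open>The main part of the first exponent decreases in \<open>j\<close>, so
        \<open>j = J\<close> is its worst case.\<close>
      have 1: "(j - J) * (2 * ln 2 / 3 + W / 3) \<ge> 0"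
        using j U L0 ln2_bounds W by (intro mult_nonneg_nonneg) auto
      have 2: "(real k + \<mu> + 1) * x\<^sup>2 \<le> (734/1000 * S + 1) * x\<^sup>2"
      proof (intro mult_right_mono)
        have "3 * (real k + \<mu> + 1) = 2 * S - j + 3" unfolding k_eq \<mu>_eq by (simp add: field_simps)
        then show "real k + \<mu> + 1 \<le> 734/1000 * S + 1" using j J(2) S by argo
      qed simp
      show "(ln (real X) + ln (real Y) - 2 * W) / 4 + \<mu> * ln 2 + (\<mu> / 4 - real k / 2) * W + 3 / 4 * d * L
          + (real k + \<mu> + 1) * x\<^sup>2 / 8 - 2 * ln 2 + 3 / 2 * \<eta> \<le> f1"
      proof -
        have "(\<mu> * ln 2 + (\<mu> / 4 - real k / 2) * W) =
            - (S + 4 * J) / 12 * (W - 4 * ln 2) - 2 * J * ln 2 - (j - J) * (2 * ln 2 / 3 + W / 3)"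
          unfolding k_eq \<mu>_eq by (simp add: field_simps)
        then have "(\<mu> * ln 2 + (\<mu> / 4 - real k / 2) * W) \<le> - (S + 4 * J) / 12 * (W - 4 * ln 2) - 2 * J * ln 2"
          using 1 by linarith
        moreover have "(734/1000 * S + 1) * x\<^sup>2 = 734/1000 * (S * x\<^sup>2) + x\<^sup>2" by (simp add: algebra_simps)
        moreover have "3 / 4 * d * L = 3/4 * (d * L)" by simp
        moreover have "0 \<le> S * x\<^sup>2" using S by simp
        moreover have "2 * (J + 1) * ln 2 = 2 * J * ln 2 + 2 * ln (2::real)" by (simp add: algebra_simps)
        moreover have "903/10000 * S * x\<^sup>2 = 903/10000 * (S * x\<^sup>2)" "16/100 * S * x\<^sup>2 = 16/100 * (S * x\<^sup>2)" by simp_all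
        ultimately show ?thesis using f1 2 dx dL xx x0 \<eta>(2) by linarith
      qed
    qed
    show "(ln (real X) + ln (real Y) - 2 * ((ln (real u) + ln (real v)) / 2)) / 2 + (ln (real v) - ln (real u)) / 2
      + (real k + (real m + real n) + 1) * ln 2 + ln (48620 / 2 ^ 18)
      + (real m + real n + 1) * ln (real v - real u) - (real m + real n) / 2 * ((ln (real u) + ln (real v)) / 2)
      + (real k + 1) * ((real v - real u) / real u)\<^sup>2 / 4 + 5 / 2 * ((real m - real n) / 2) * ((real v - real u) / real u)
      + \<eta> / 2 \<le> f2"
      unfolding \<mu>_def[symmetric] W_def[symmetric] d_eq L_def[symmetric] x_def[symmetric] unfolding e_def[symmetric]
    proof -
      \<comment> \<open>By \<open>We\<close> the main part of the second exponent increases in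
        \<open>j\<close>, so the worst case is \<open>j = J + 5\<close>; hence \<open>J + 6\<close>
        and \<open>S - 2 * J - 10\<close> in the hypothesis on \<open>f2\<close>.\<close>
      have 1: "(J + 5 - j) * ((W - 2 * ln e - ln 2) / 3) \<ge> 0"
        using j We by (intro mult_nonneg_nonneg) auto
      have 2: "(real k + 1) * x\<^sup>2 \<le> ((S + 7) / 3) * x\<^sup>2"
      proof (intro mult_right_mono)
        have "3 * real k = S + j" unfolding j_def by simp
        then show "real k + 1 \<le> (S + 7) / 3" using j J' by argo
      qed simp
      show "(ln (real X) + ln (real Y) - 2 * W) / 2 + L / 2 + (real k + \<mu> + 1) * ln 2 + ln (48620 / 2 ^ 18)
          + (\<mu> + 1) * ln e - \<mu> / 2 * W + (real k + 1) * x\<^sup>2 / 4 + 5 / 2 * d * x + \<eta> / 2 \<le> f2"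
      proof -
        have "(real k + \<mu> + 1) * ln 2 + (\<mu> + 1) * ln e - \<mu> / 2 * W =
            ln e + (J + 6) * ln 2 - (S - 2 * J - 10) / 6 * \<Delta> - (J + 5 - j) * ((W - 2 * ln e - ln 2) / 3)"
          unfolding k_eq \<mu>_eq \<Delta>_def by (simp add: field_simps)
        then have "(real k + \<mu> + 1) * ln 2 + (\<mu> + 1) * ln e - \<mu> / 2 * W
            \<le> ln e + (J + 6) * ln 2 - (S - 2 * J - 10) / 6 * \<Delta>"
          using 1 by linarith
        moreover have "((S + 7) / 3) * x\<^sup>2 = (S * x\<^sup>2) / 3 + 7/3 * x\<^sup>2" by (simp add: algebra_simps)
        moreover have "5 / 2 * d * x = 5/2 * (d * x)" by simp
        moreover have "0 \<le> S * x\<^sup>2" using S by simp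
        moreover have "903/10000 * S * x\<^sup>2 = 903/10000 * (S * x\<^sup>2)" "33/100 * S * x\<^sup>2 = 33/100 * (S * x\<^sup>2)" by simp_all
        ultimately show ?thesis using f2 2 dx L0 xx x0 \<eta>(2) ln_binomial_18 by linarith
      qed
    qed
  qed
qed

section \<open>Close pairs of powers\<close>

text \<open>Reduces the final tests on sums of exponentials to rational arithmetic.\<close>

lemma exp_neg_le:
  fixes t :: real
  assumes "0 \<le> t"
  shows "exp (- t) \<le> 1 / (1 + t + t\<^sup>2 / 2)"
proof -
  have "1 + t + t\<^sup>2 / 2 \<le> exp t" by (rule exp_lower_Taylor_quadratic[OF assms])
  moreover have "0 < 1 + t + t\<^sup>2 / 2" using assms by (simp add: add_pos_nonneg)
  ultimately show ?thesis by (simp add: exp_minus divide_simps)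
qed

lemma ln2_mult_le:
  fixes z :: real
  assumes "2 ^ a \<le> z ^ b" "0 < z"
  shows "real a * ln 2 \<le> real b * ln z"
proof -
  have "ln (2 ^ a) \<le> ln (z ^ b)" using assms by (subst ln_le_cancel_iff) auto
  then show ?thesis by (simp only: ln_realpow)
qed

text \<open>The difference is below \<open>sqrt b / 4\<close>, hence below \<open>b / 16\<close>
  because \<open>sqrt b \<ge> 4\<close>. So \<open>a \<ge> 15 / 16 * b\<close>, and
  \<open>ln (b / a) \<le> (b - a) / a\<close>.\<close>

lemma ln_diff_le_of_close:
  fixes a b :: real
  assumes "0 < a" "a \<le> b" "32 \<le> b" "16 * (b - a)\<^sup>2 < b"
  shows "ln b - ln a \<le> 4 / (15 * sqrt b)"
proof -
  define y where "y = sqrt b"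
  have y: "y * y = b" "0 < y" using assms by (simp_all add: y_def)
  have "(4 * (b - a))\<^sup>2 < y\<^sup>2" using assms unfolding power_mult_distrib y_def by simp
  then have d: "4 * (b - a) < y" by (rule power2_less_imp_less) (use y(2) in simp)
  have "4 \<le> y"
  proof -
    have "4\<^sup>2 \<le> b" using assms by simp
    then show ?thesis unfolding y_def by (rule real_le_rsqrt)
  qed
  then have "4 * y \<le> b" using y by (metis mult_right_mono less_imp_le)
  with d have a: "15 / 16 * b \<le> a" by argo
  have "ln b - ln a = ln (1 + (b - a) / a)"
  proof -
    have "b = a * (1 + (b - a) / a)" using assms by (simp add: field_simps)
    then have "ln b = ln a + ln (1 + (b - a) / a)"
      using assms by (metis ln_mult_pos add_pos_nonneg diff_ge_0_iff_ge divide_nonneg_pos zero_less_one)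
    then show ?thesis by simp
  qed
  also have "\<dots> \<le> (b - a) / a" using assms by (intro ln_add_one_self_le_self) auto
  also have "\<dots> \<le> (y / 4) / (15 / 16 * b)" using a d assms by (intro frac_le) auto
  also have "\<dots> = 4 / (15 * y)" using y by (simp add: field_simps flip: y(1))
  finally show ?thesis by (simp add: y_def)
qed

text \<open>The first pair is ordered increasingly; the order of \<open>g ^ q\<close> and
  \<open>h ^ s\<close> stays open, whence the maxima. Exchanging the triples \<open>g, p, q\<close>
  and \<open>h, r, s\<close> covers both signs of the first perturbation.\<close>

locale close_powers =
  fixes g h p q r s :: nat
  assumes g2: "2 \<le> g" and h2: "2 \<le> h" and pos: "0 < p" "0 < q" "0 < r" "0 < s"
    and lt: "g ^ p < h ^ r" and v17: "17 \<le> h ^ r"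
    and close: "16 * (real (h ^ r) - real (g ^ p))\<^sup>2 < real (h ^ r)"
    and neq: "g ^ q \<noteq> h ^ s"
    and close': "16 * (real (h ^ s) - real (g ^ q))\<^sup>2 < max (real (h ^ s)) (real (g ^ q))"
    and large: "2 * real (g ^ p) \<le> max (real (h ^ s)) (real (g ^ q))"
    and ratio: "p * s \<noteq> q * r"
begin

definition "u = real g ^ p"
definition "v = real h ^ r"
definition "e = v - u"
definition "x = e / u"
definition "U = ln u"
definition "V = ln v"
definition "W = (U + V) / 2"
definition "L = V - U"
definition "M = max (real (h ^ s)) (real (g ^ q))"
definition "\<eta> = 4 / (15 * sqrt M)"
definition "N1 = q div p"
definition "N2 = s div r"
definition "S = real N1 + real N2 - 2"
definition "Y = g ^ (q mod p)"
definition "X = h ^ (s mod r)"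

lemma u_eq: "real (g ^ p) = u" and v_eq: "real (h ^ r) = v"
  by (simp_all add: u_def v_def)

lemma u_pos: "0 < u" using g2 by (simp add: u_def)

lemma U_eq: "U = p * ln g" and V_eq: "V = r * ln h"
  by (simp_all add: U_def V_def u_def v_def ln_realpow)

lemma e_ge1: "1 \<le> e"
proof -
  have "real (g ^ p) + 1 \<le> real (h ^ r)" using lt by (metis Suc_leI of_nat_Suc of_nat_le_iff add.commute)
  then show ?thesis by (simp add: e_def u_def v_def)
qed

text \<open>Both sides of \<open>close\<close> are integers, so strictness gains 1. This counts when
  \<open>v\<close> is near \<open>16 * e ^ 2\<close>.\<close>

lemma v_ge: "16 * e\<^sup>2 + 1 \<le> v"
proof -
  have "16 * (int (h ^ r) - int (g ^ p))\<^sup>2 < int (h ^ r)"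
  proof -
    have "real_of_int (16 * (int (h ^ r) - int (g ^ p))\<^sup>2) < real_of_int (int (h ^ r))"
      using close by simp
    then show ?thesis by (simp only: of_int_less_iff)
  qed
  then have "16 * (int (h ^ r) - int (g ^ p))\<^sup>2 + 1 \<le> int (h ^ r)" by linarith
  then have "real_of_int (16 * (int (h ^ r) - int (g ^ p))\<^sup>2 + 1) \<le> real_of_int (int (h ^ r))"
    by (simp only: of_int_le_iff)
  then show ?thesis by (simp add: e_def u_def v_def)
qed

lemma u_ge: "16 * e\<^sup>2 - e + 1 \<le> u"
  using v_ge by (simp add: e_def)

lemma e_sq: "e \<le> e\<^sup>2" using mult_left_mono[OF e_ge1, of e] e_ge1 by (simp add: power2_eq_square)

lemma u16: "16 \<le> u"
  using u_ge e_sq e_ge1 by linarith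

lemma e_cases: "e = 1 \<or> 2 \<le> e"
proof -
  define k where "k = int (h ^ r) - int (g ^ p)"
  have "e = real_of_int k" by (simp add: k_def e_def u_def v_def)
  moreover have "k = 1 \<or> 2 \<le> k" using lt by (auto simp: k_def simp del: of_nat_power)
  ultimately show ?thesis by auto
qed

lemma x_pos: "0 < x" using e_ge1 u_pos by (simp add: x_def)

lemma x_le16: "x \<le> 1 / 16"
proof -
  have "16 * e \<le> u"
    using e_cases
  proof
    assume "2 \<le> e"
    then have "2 * e \<le> e\<^sup>2" by (simp add: power2_eq_square)
    then show ?thesis using u_ge e_ge1 by linarith
  qed (use u16 in simp)
  then show ?thesis using u_pos by (simp add: x_def divide_simps)
qed

lemma V_minus_U: "L = ln (1 + x)"
proof -
  have "v = u * (1 + x)" using u_pos by (simp add: x_def e_def field_simps)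
  then have "V = U + ln (1 + x)" using u_pos x_pos by (simp add: V_def U_def ln_mult_pos)
  then show ?thesis by (simp add: L_def)
qed

lemma L_bounds: "0 < L" "L \<le> x" "x - x\<^sup>2 / 2 \<le> L"
  using x_pos ln_add_one_self_le_self[of x] ln_one_plus_ge_quadratic[of x] by (simp_all add: V_minus_U)

lemma U_ge: "4 * ln 2 \<le> U"
  using ln2_mult_le[of 4 u 1] u16 by (simp add: U_def)

lemma UV_pos: "0 < U" "0 < V"
  using U_ge ln2_bounds L_bounds by (simp_all add: L_def)

lemma W_eq: "W = U + L / 2" by (simp add: W_def L_def field_simps)

lemma ln_g: "693/1000 \<le> ln g" and ln_h: "693/1000 \<le> ln h"
proof -
  have "ln 2 \<le> ln (real g)" "ln 2 \<le> ln (real h)" using g2 h2 by auto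
  then show "693/1000 \<le> ln g" "693/1000 \<le> ln h" using ln2_bounds by auto
qed

lemma M_u: "2 * u \<le> M"
  using large unfolding M_def u_eq .

lemma M32: "32 \<le> M"
  using M_u u16 by linarith

lemma \<eta>_pos: "0 < \<eta>" using M32 by (simp add: \<eta>_def)

lemma \<eta>_le: "\<eta> \<le> 6 / 100"
proof -
  have "5 \<le> sqrt M" using M32 by (intro real_le_rsqrt) auto
  then have "4 / (15 * sqrt M) \<le> 4 / (15 * 5)" using M32 by (intro divide_left_mono) auto
  then show ?thesis unfolding \<eta>_def by simp
qed

lemma ln_close: "\<bar>q * ln g - s * ln h\<bar> \<le> \<eta>"
proof -
  have *: "\<bar>ln (real (g ^ q)) - ln (real (h ^ s))\<bar> \<le> \<eta>"
  proof (cases "g ^ q \<le> h ^ s")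
    case True
    then have M: "M = real (h ^ s)" unfolding M_def max_def by (metis of_nat_le_iff order_antisym)
    have le: "real (g ^ q) \<le> real (h ^ s)" using True by (simp only: of_nat_le_iff)
    have "ln (real (h ^ s)) - ln (real (g ^ q)) \<le> \<eta>"
      unfolding \<eta>_def M using le M32 close' M g2 h2
      by (intro ln_diff_le_of_close) (auto simp: M_def)
    moreover have "ln (real (g ^ q)) \<le> ln (real (h ^ s))" using le g2 h2 by (subst ln_le_cancel_iff) auto
    ultimately show ?thesis by simp
  next
    case False
    then have le: "real (h ^ s) \<le> real (g ^ q)" by (metis of_nat_le_iff nat_le_linear)
    then have M: "M = real (g ^ q)" unfolding M_def by (simp add: max_def del: of_nat_power)
    have "ln (real (g ^ q)) - ln (real (h ^ s)) \<le> \<eta>"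
      unfolding \<eta>_def M using le M32 close' M g2 h2
      by (intro ln_diff_le_of_close) (auto simp: M_def power2_commute)
    moreover have "ln (real (h ^ s)) \<le> ln (real (g ^ q))" using le g2 h2 by (subst ln_le_cancel_iff) auto
    ultimately show ?thesis by simp
  qed
  then show ?thesis by (simp add: ln_realpow)
qed

text \<open>Eliminating a logarithm gives
  \<open>s * L = r * (s * ln h - q * ln g) + k * ln g\<close> with \<open>k = q * r - p * s\<close>,
  and similarly \<open>q * L\<close> in terms of \<open>ln h\<close>. The left sides are positive
  and a first summand is tiny, so the integer \<open>k\<close> cannot be negative; by
  \<open>ratio\<close> it is not zero.\<close>

lemma exponent_gap:
  assumes "r * \<eta> < 693/1000 \<or> p * \<eta> < 693/1000"
  shows "real (p * s) + 1 \<le> real (q * r)"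
proof -
  define k where "k = real (q * r) - real (p * s)"
  have c: "q * ln g - s * ln h \<le> \<eta>" "s * ln h - q * ln g \<le> \<eta>" using ln_close by auto
  have c1: "r * (q * ln g - s * ln h) \<le> r * \<eta>" "r * (s * ln h - q * ln g) \<le> r * \<eta>"
    using c by (intro mult_left_mono; simp)+
  have c2: "p * (q * ln g - s * ln h) \<le> p * \<eta>" "p * (s * ln h - q * ln g) \<le> p * \<eta>"
    using c by (intro mult_left_mono; simp)+
  have sL: "0 < s * L" and qL: "0 < q * L" using pos L_bounds by auto
  have "s * L = r * (s * ln h - q * ln g) + k * ln g"
    by (simp add: L_def U_eq V_eq k_def algebra_simps)
  then have A: "0 < r * \<eta> + k * ln g" using sL c1 by linarith
  have "q * L = p * (s * ln h - q * ln g) + k * ln h"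
    by (simp add: L_def U_eq V_eq k_def algebra_simps)
  then have B: "0 < p * \<eta> + k * ln h" using qL c2 by linarith
  have "-1 < k"
  proof (rule ccontr)
    assume "\<not> -1 < k"
    then have "k * ln g \<le> -1 * ln g" "k * ln h \<le> -1 * ln h"
      using ln_g ln_h by (intro mult_right_mono; simp)+
    then show False using A B assms ln_g ln_h by argo
  qed
  then have "real (p * s) < real (q * r) + 1" by (simp add: k_def)
  then have "p * s < q * r + 1" by linarith
  then have "p * s + 1 \<le> q * r" using ratio by simp
  then show ?thesis by (metis of_nat_1 of_nat_add of_nat_le_iff)
qed

text \<open>In multiplicative terms \<open>(v / u) ^ s\<close> is at least nearly \<open>g\<close>,
  which forces \<open>s\<close> to be at least of order \<open>1 / x\<close>. All lower bounds on
  exponents rest on this and on its mirror image \<open>q_lower\<close>.\<close>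

lemma s_lower:
  assumes "r * \<eta> \<le> 6/100"
  shows "ln g - 6/100 \<le> s * L"
proof -
  have "s * ln h - q * ln g \<ge> - \<eta>" using ln_close by auto
  then have "r * (s * ln h - q * ln g) \<ge> r * (- \<eta>)" by (intro mult_left_mono) auto
  moreover have "1 * ln g \<le> (real (q * r) - real (p * s)) * ln g"
    using exponent_gap assms ln_g by (intro mult_right_mono) auto
  moreover have "s * L = r * (s * ln h - q * ln g) + (real (q * r) - real (p * s)) * ln g"
    by (simp add: L_def U_eq V_eq algebra_simps)
  ultimately show ?thesis using assms by simp
qed

lemma q_lower:
  assumes "p = 1"
  shows "ln h - 6/100 \<le> q * L"
proof -
  have "s * ln h - q * ln g \<ge> - \<eta>" using ln_close by auto
  moreover have "1 * ln h \<le> (real (q * r) - real (p * s)) * ln h"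
    using exponent_gap assms ln_h \<eta>_le by (intro mult_right_mono) auto
  moreover have "q * L = p * (s * ln h - q * ln g) + (real (q * r) - real (p * s)) * ln h"
    by (simp add: L_def U_eq V_eq algebra_simps)
  ultimately show ?thesis using assms \<eta>_le by simp
qed

lemma g_pow_q: "g ^ q = (g ^ p) ^ N1 * Y" and h_pow_s: "h ^ s = (h ^ r) ^ N2 * X"
  by (simp_all add: N1_def N2_def X_def Y_def flip: power_mult power_add)

lemma ln_X: "0 \<le> ln X" "ln X \<le> V - ln h" and ln_Y: "0 \<le> ln Y" "ln Y \<le> U - ln g"
proof -
  have "(s mod r) * ln h \<le> (real r - 1) * ln h" "(q mod p) * ln g \<le> (real p - 1) * ln g"
  proof -
    have "s mod r < r" "q mod p < p" using pos by simp_all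
    then have "real (s mod r) + 1 \<le> real r" "real (q mod p) + 1 \<le> real p" by linarith+
    then show "(s mod r) * ln h \<le> (real r - 1) * ln h" "(q mod p) * ln g \<le> (real p - 1) * ln g"
      using ln_g ln_h by (intro mult_right_mono; simp)+
  qed
  then show "0 \<le> ln X" "ln X \<le> V - ln h" "0 \<le> ln Y" "ln Y \<le> U - ln g"
    using ln_g ln_h by (simp_all add: X_def Y_def ln_realpow U_eq V_eq algebra_simps)
qed

lemma ln_close': "\<bar>(N1 * U + ln Y) - (N2 * V + ln X)\<bar> \<le> \<eta>"
proof -
  have "q * ln g = N1 * U + ln Y" "s * ln h = N2 * V + ln X"
  proof -
    have "ln (real (g ^ q)) = ln (real ((g ^ p) ^ N1 * Y))" "ln (real (h ^ s)) = ln (real ((h ^ r) ^ N2 * X))"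
      using g_pow_q h_pow_s by simp_all
    then show "q * ln g = N1 * U + ln Y" "s * ln h = N2 * V + ln X"
      using g2 h2 by (simp_all add: ln_mult ln_realpow U_eq V_eq X_def Y_def algebra_simps)
  qed
  then show ?thesis using ln_close by simp
qed

text \<open>Otherwise \<open>v ^ N2 * X\<close> exceeds \<open>u ^ (N1 + 1)\<close>, and so exceeds
  \<open>u ^ N1 * Y\<close> by a factor of at least \<open>g\<close>, because
  \<open>Y \<le> u / g\<close>.\<close>

lemma N2_le_N1: "N2 \<le> N1"
proof (rule ccontr)
  assume "\<not> N2 \<le> N1"
  then have "real N1 + 1 \<le> real N2" by linarith
  then have "(real N1 + 1) * V \<le> real N2 * V"
    using UV_pos by (intro mult_right_mono) auto
  moreover have "real N1 * U \<le> real N1 * V" using L_bounds by (intro mult_left_mono) (auto simp: L_def)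
  ultimately have "ln g - L \<le> \<eta> - L"
    using ln_close' ln_X ln_Y L_bounds by (simp add: algebra_simps L_def abs_le_iff)
  then show False using \<eta>_le ln_g by linarith
qed

text \<open>The interface to \<open>power_pair_contradiction\<close>: \<open>R\<close> bounds the
  logarithm of \<open>X * Y / (u * v)\<close>, \<open>f1\<close> and \<open>f2\<close> are now
  gains, with the opposite sign, and the final test is rational.\<close>

lemma contradictionI:
  fixes J :: int and f1 f2 R :: real
  assumes R: "ln X + ln Y - 2 * W \<le> R" and S: "28 \<le> S" and J: "J \<le> -1" "- S / 5 \<le> real_of_int J"
    and f1: "R / 4 - (S + 4 * J) / 12 * (W - 4 * ln 2) - 2 * (J + 1) * ln 2 + 16/100 * S * x\<^sup>2 + x + 1/10 \<le> - f1"
    and f2: "R / 2 + ln e + (J + 6) * ln 2 - 168/100 - (S - 2 * J - 10) / 6 * (W - 4 * ln 2 - 2 * ln e)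
        + 33/100 * S * x\<^sup>2 + 2 * x + 4/100 \<le> - f2"
    and f0: "0 \<le> f1" "0 \<le> f2"
    and f12: "1 / (1 + f1 + f1\<^sup>2 / 2) + 1 / (1 + f2 + f2\<^sup>2 / 2) < 1"
  shows False
proof (rule power_pair_contradiction[of "g ^ p" "h ^ r" X Y N2 N1 \<eta> J "- f1" "- f2"])
  have R4: "(ln X + ln Y - 2 * W) / 4 \<le> R / 4" and R2: "(ln X + ln Y - 2 * W) / 2 \<le> R / 2"
    using R by simp_all
  note eqs = u_eq v_eq e_def[symmetric] x_def[symmetric] U_def[symmetric] V_def[symmetric] W_def[symmetric]
    S_def[symmetric]
  show "16 \<le> g ^ p" using u16 u_eq by (metis of_nat_le_iff of_nat_numeral)
  show "g ^ p < h ^ r" by (rule lt)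
  show "(real (h ^ r) - real (g ^ p)) / real (g ^ p) \<le> 1 / 16" unfolding eqs by (rule x_le16)
  show "0 < X" "0 < Y" using g2 h2 by (simp_all add: X_def Y_def)
  show "X \<le> h ^ r" unfolding X_def using h2 pos by (intro power_increasing) (auto simp: less_imp_le)
  show "N2 \<le> N1" by (rule N2_le_N1)
  show "(g ^ p) ^ N1 * Y \<noteq> (h ^ r) ^ N2 * X" using neq g_pow_q h_pow_s by simp
  show "16 * (real ((h ^ r) ^ N2 * X) - real ((g ^ p) ^ N1 * Y))\<^sup>2
      < max (real ((h ^ r) ^ N2 * X)) (real ((g ^ p) ^ N1 * Y))"
    using close' unfolding g_pow_q h_pow_s .
  show "\<bar>ln (real ((g ^ p) ^ N1 * Y)) - ln (real ((h ^ r) ^ N2 * X))\<bar> \<le> \<eta>"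
    using ln_close unfolding g_pow_q[symmetric] h_pow_s[symmetric] by (simp add: ln_realpow)
  show "\<eta> \<le> 6 / 100" by (rule \<eta>_le)
  show "28 \<le> real N1 + real N2 - 2" using S unfolding S_def .
  show "J \<le> -1" by (rule J)
  show "- (real N1 + real N2 - 2) / 5 \<le> real_of_int J" using J(2) unfolding S_def .
  show "2 * ln (real (h ^ r) - real (g ^ p)) + ln 2 \<le> (ln (real (g ^ p)) + ln (real (h ^ r))) / 2"
    unfolding eqs
  proof -
    have "e\<^sup>2 * 2 \<le> u" using u_ge e_sq e_ge1 by linarith
    then have "ln (e\<^sup>2 * 2) \<le> U" unfolding U_def using e_ge1 by (subst ln_le_cancel_iff) (auto simp: u_pos)
    then show "2 * ln e + ln 2 \<le> W" using e_ge1 L_bounds by (simp add: ln_mult ln_realpow W_eq)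
  qed
  show "(ln (real X) + ln (real Y) - 2 * ((ln (real (g ^ p)) + ln (real (h ^ r))) / 2)) / 4
    - (real N1 + real N2 - 2 + real_of_int (4 * J)) / 12 * ((ln (real (g ^ p)) + ln (real (h ^ r))) / 2 - 4 * ln 2)
    - real_of_int (2 * (J + 1)) * ln 2 + 16 / 100 * (real N1 + real N2 - 2) * ((real (h ^ r) - real (g ^ p)) / real (g ^ p))\<^sup>2
    + (real (h ^ r) - real (g ^ p)) / real (g ^ p) + 1 / 10 \<le> - f1"
    unfolding eqs using f1 R4 by linarith
  show "(ln (real X) + ln (real Y) - 2 * ((ln (real (g ^ p)) + ln (real (h ^ r))) / 2)) / 2
    + ln (real (h ^ r) - real (g ^ p)) + real_of_int (J + 6) * ln 2 - 168 / 100
    - (real N1 + real N2 - 2 - real_of_int (2 * J) - 10) / 6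
      * ((ln (real (g ^ p)) + ln (real (h ^ r))) / 2 - 4 * ln 2 - 2 * ln (real (h ^ r) - real (g ^ p)))
    + 33 / 100 * (real N1 + real N2 - 2) * ((real (h ^ r) - real (g ^ p)) / real (g ^ p))\<^sup>2
    + 2 * ((real (h ^ r) - real (g ^ p)) / real (g ^ p)) + 4 / 100 \<le> - f2"
    unfolding eqs using f2 R2 by linarith
  show "exp (- f1) + exp (- f2) < 1"
    using exp_neg_le[OF f0(1)] exp_neg_le[OF f0(2)] f12 by linarith
qed

end

section \<open>Pairs in which one of \<open>p\<close>, \<open>r\<close> is 1\<close>

context close_powers
begin

lemma S_ge: "2 * real N2 - 2 \<le> S"
  using N2_le_N1 by (simp add: S_def)

text \<open>The lower bounds for \<open>u\<close> and \<open>v\<close> give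
  \<open>248 * e ^ 4 \<le> u * v\<close>, and 248 is \<open>2 ^ 8\<close> times
  \<open>31 / 32\<close>. This quantity is the rate at which the remainder term gains with
  \<open>S\<close>; where it might be negative, a \<open>J\<close> decreasing in proportion to
  \<open>S\<close> makes up for the loss.\<close>

lemma Delta_ge: "- (1 / 62) \<le> W - 4 * ln 2 - 2 * ln e"
proof -
  have "248 * e ^ 4 \<le> u * v"
  proof -
    have "0 \<le> 8 * (e\<^sup>2 * ((e - 1)\<^sup>2 + 3)) - e + 1"
    proof -
      have "e\<^sup>2 * 3 \<le> e\<^sup>2 * ((e - 1)\<^sup>2 + 3)" by (intro mult_left_mono) auto
      then show ?thesis using e_sq e_ge1 by linarith
    qed
    then have "248 * e ^ 4 \<le> (16 * e\<^sup>2 - e + 1) * (16 * e\<^sup>2 + 1)"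
      by (simp add: algebra_simps power2_eq_square power4_eq_xxxx)
    also have "\<dots> \<le> u * v" using u_ge v_ge u_pos e_sq e_ge1 by (intro mult_mono) auto
    finally show ?thesis .
  qed
  then have "ln (248 * e ^ 4) \<le> ln (u * v)"
    using e_ge1 u_pos h2 by (subst ln_le_cancel_iff) (auto simp: v_def intro!: mult_pos_pos)
  then have 1: "ln 248 + 4 * ln e \<le> U + V"
    using e_ge1 u_pos h2 by (simp add: ln_mult ln_realpow U_def V_def v_def)
  have "ln (1 + 1 / 31 :: real) \<le> 1 / 31" by (rule ln_add_one_self_le_self) simp
  moreover have "ln 248 + ln (1 + 1 / 31 :: real) = ln (248 * (1 + 1 / 31))" by (rule ln_mult_pos[symmetric]) auto
  moreover have "ln (248 * (1 + 1 / 31 :: real)) = 8 * ln 2"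
  proof -
    have "(248::real) * (1 + 1 / 31) = 2 ^ 8" by simp
    then show ?thesis by (simp only: ln_realpow of_nat_numeral)
  qed
  ultimately have "8 * ln 2 - 1 / 31 \<le> ln (248::real)" by linarith
  with 1 show ?thesis unfolding W_def by argo
qed

text \<open>For \<open>r = 1\<close> one takes \<open>n = s = N2\<close>. For \<open>p = 1\<close>
  one takes \<open>n = q = N1\<close>, and comparing sizes gives
  \<open>N2 + 1 \<ge> q * (1 - x / V)\<close>. The constant is
  \<open>693 / 1000 - 6 / 100\<close>.\<close>

lemma length_bound:
  assumes "p = 1 \<or> r = 1"
  obtains n :: nat where "633 / 1000 \<le> n * x" "2 * real n - 3 - n * x / V \<le> S"
proof (cases "r = 1")
  case True
  have "s * L \<le> s * x" using L_bounds by (intro mult_left_mono) auto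
  then have "633 / 1000 \<le> s * x" using s_lower True \<eta>_le ln_g by simp
  moreover have "N2 = s" unfolding N2_def using True by simp
  then have "2 * real s - 3 - s * x / V \<le> S"
    using S_ge x_pos UV_pos by (smt (verit, best) divide_nonneg_pos mult_nonneg_nonneg of_nat_0_le_iff)
  ultimately show ?thesis by (rule that)
next
  case False
  then have p: "p = 1" using assms by simp
  have "q * L \<le> q * x" using L_bounds by (intro mult_left_mono) auto
  then have "633 / 1000 \<le> q * x" using q_lower[OF p] ln_h by simp
  moreover have N1: "N1 = q" unfolding N1_def using p by simp
  have "real N1 * (V - x) \<le> real N1 * U" using L_bounds by (intro mult_left_mono) (auto simp: L_def)
  then have "real q * (V - x) \<le> (N2 + 1) * V"
    using ln_close' ln_X ln_Y \<eta>_le ln_h unfolding N1 by (simp add: abs_le_iff algebra_simps)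
  then have "real q * (V - x) / V \<le> N2 + 1" using UV_pos by (simp add: divide_le_eq)
  moreover have "real q * (V - x) / V = q - q * x / V" using UV_pos by (simp add: field_simps)
  ultimately have "2 * real q - 3 - q * x / V \<le> S" by (simp add: S_def N1)
  with \<open>633 / 1000 \<le> q * x\<close> show ?thesis by (rule that)
qed

text \<open>One cofactor is 1 and the other is at most half of the corresponding \<open>u\<close> or
  \<open>v\<close>.\<close>

lemma R_le:
  assumes "p = 1 \<or> r = 1"
  shows "ln X + ln Y - 2 * W \<le> - U - ln 2"
proof -
  have lng: "ln 2 \<le> ln (real g)" "ln 2 \<le> ln (real h)" using g2 h2 by auto
  have "2 * W = U + V" by (simp add: W_def)
  moreover have "ln Y = 0" if "p = 1" unfolding Y_def using that by simp
  moreover have "ln X = 0" if "r = 1" unfolding X_def using that by simp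
  ultimately show ?thesis using assms ln_X ln_Y lng L_bounds by (auto simp: L_def)
qed

text \<open>The hypotheses make \<open>n0\<close> a lower bound for the \<open>n\<close> of
  \<open>length_bound\<close>, and the resulting bound for \<open>S\<close> increases with
  \<open>n\<close>.\<close>

lemma S_from_length:
  assumes "p = 1 \<or> r = 1" "x \<le> c" "633 / 1000 > (real n0 - 1) * c" "27 / 10 \<le> V" "c \<le> 1"
  shows "2 * real n0 - 3 - real n0 * c / (27 / 10) \<le> S"
proof -
  obtain n :: nat where n: "633 / 1000 \<le> n * x" "2 * real n - 3 - n * x / V \<le> S"
    using length_bound[OF assms(1)] by metis
  have c0: "0 < c" using assms x_pos by linarith
  have "n * x \<le> n * c" using assms by (intro mult_left_mono) auto
  then have "(real n0 - 1) * c < n * c" using n assms by linarith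
  then have "real n0 < real (n + 1)" using c0 by simp
  then have nn: "real n0 \<le> n" unfolding of_nat_less_iff by simp
  have "n * x / V \<le> n * c / (27 / 10)"
    using assms x_pos by (intro frac_le mult_left_mono mult_nonneg_nonneg) auto
  moreover have "real n0 * (2 - c / (27/10)) \<le> n * (2 - c / (27/10))"
    using nn assms by (intro mult_right_mono) auto
  moreover have "real n0 * (2 - c / (27/10)) = 2 * real n0 - real n0 * c / (27 / 10)"
    "n * (2 - c / (27/10)) = 2 * real n - n * c / (27 / 10)" by (simp_all add: algebra_simps)
  ultimately show ?thesis using n by linarith
qed

lemma case_distant:
  assumes "p = 1 \<or> r = 1" "2 \<le> e"
  shows False
proof -
  have u_e: "31.5 * e \<le> u" "15.5 * e\<^sup>2 \<le> u"
  proof -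
    have "0 \<le> (e - 2) * (16 * e - 1/2)" using assms by simp
    then have "31.5 * e \<le> 16 * e\<^sup>2 - e + 1" by (simp add: algebra_simps power2_eq_square)
    then show "31.5 * e \<le> u" using u_ge by linarith
    have "0 \<le> (e - 1)\<^sup>2 + 1" by simp
    then have "15.5 * e\<^sup>2 \<le> 16 * e\<^sup>2 - e + 1" by (simp add: algebra_simps power2_eq_square)
    then show "15.5 * e\<^sup>2 \<le> u" using u_ge by linarith
  qed
  have u63: "63 \<le> u" using u_e assms by linarith
  have x: "x \<le> 2 / 63" using u_e u_pos by (simp add: x_def divide_simps)
  have "63 ^ 20 \<le> u ^ 20" using u63 by (intro power_mono) auto
  then have "real 119 * ln 2 \<le> real 20 * ln u" by (intro ln2_mult_le) (use u63 in auto)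
  then have U: "595/100 * ln 2 \<le> U" by (simp add: U_def)
  have Ue: "495/100 * ln 2 + 2 * ln e \<le> U + ln 2"
  proof -
    have "99 * ln 2 \<le> 20 * ln (31::real)" using ln2_mult_le[of 99 31 20] by simp
    moreover have "ln (31 * e\<^sup>2) \<le> ln (2 * u)" using u_e assms u_pos by (subst ln_le_cancel_iff) auto
    then have "ln 31 + 2 * ln e \<le> U + ln 2" using assms u_pos by (simp add: ln_mult ln_realpow U_def)
    ultimately show ?thesis by argo
  qed
  have V: "27/10 \<le> V" using U ln2_bounds L_bounds by (simp add: L_def)
  have S: "36 \<le> S" using S_from_length[of "2/63" 20] assms x V by simp
  define n where "n = int N1 + int N2 - 2"
  have Sn: "S = real_of_int n" by (simp add: S_def n_def)
  \<comment> \<open>With \<open>J = - 2 - f\<close> the second exponent gains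
    \<open>f * ln 2\<close>, which outweighs the loss of about \<open>S / 372\<close> permitted by
    \<open>Delta_ge\<close>. The first exponent can afford this, as \<open>W - 4 * ln 2\<close>
    exceeds 1.35.\<close>
  define f where "f = n div 100"
  have f: "0 \<le> real_of_int f" "100 * real_of_int f \<le> S" "S \<le> 100 * real_of_int f + 99"
  proof -
    have "0 \<le> n" using S Sn by linarith
    then have "0 \<le> f" "100 * f \<le> n" "n \<le> 100 * f + 99" unfolding f_def by presburger+
    then show "0 \<le> real_of_int f" "100 * real_of_int f \<le> S" "S \<le> 100 * real_of_int f + 99"
      unfolding Sn by linarith+
  qed
  define R where "R = ln X + ln Y - 2 * W"
  have R: "R \<le> - U - ln 2" unfolding R_def by (rule R_le[OF assms(1)])
  have xx: "S * x\<^sup>2 \<le> 101/100000 * S"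
  proof -
    have "x\<^sup>2 \<le> (2 / 63)\<^sup>2" using x x_pos by (intro power_mono) auto
    also have "\<dots> \<le> 101/100000" by (simp add: power_divide)
    finally show ?thesis using S mult_left_mono[of "x\<^sup>2" "101/100000" S] by simp
  qed
  show False
  proof (rule contradictionI[where J = "- 2 - f" and R = R and ?f1.0 = "21/10" and ?f2.0 = "225/1000"])
    show "ln X + ln Y - 2 * W \<le> R" by (simp add: R_def)
    show "28 \<le> S" "- 2 - f \<le> - 1" using S f by linarith+
    show "- S / 5 \<le> real_of_int (- 2 - f)" using S f by simp
    show "R / 4 - (S + real_of_int (4 * (- 2 - f))) / 12 * (W - 4 * ln 2) - real_of_int (2 * (- 2 - f + 1)) * ln 2
        + 16 / 100 * S * x\<^sup>2 + x + 1 / 10 \<le> - (21 / 10)"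
    proof -
      have w: "1351/1000 \<le> W - 4 * ln 2" using U ln2_bounds L_bounds by (simp add: W_eq)
      have "(96/100 * S - 8) / 12 * (1351/1000) \<le> (S + real_of_int (4 * (- 2 - f))) / 12 * (W - 4 * ln 2)"
        using w f S by (intro mult_mono) auto
      moreover have "real_of_int (2 * (- 2 - f + 1)) * ln 2 = - ((2 + 2 * real_of_int f) * ln 2)" by (simp add: algebra_simps)
      moreover have "(2 + 2 * real_of_int f) * ln 2 \<le> (2 + 2 * S / 100) * (6932/10000)"
        using ln2_bounds f by (intro mult_mono) auto
      ultimately show ?thesis using R U ln2_bounds S xx x by argo
    qed
    show "R / 2 + ln e + real_of_int (- 2 - f + 6) * ln 2 - 168 / 100
        - (S - real_of_int (2 * (- 2 - f)) - 10) / 6 * (W - 4 * ln 2 - 2 * ln e)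
        + 33 / 100 * S * x\<^sup>2 + 2 * x + 4 / 100 \<le> - (225 / 1000)"
    proof -
      have eq1: "S - real_of_int (2 * (- 2 - f)) - 10 = S - 6 + 2 * real_of_int f" by simp
      have eq2: "real_of_int (- 2 - f + 6) * ln 2 = 4 * ln 2 - real_of_int f * ln 2" by (simp add: algebra_simps)
      have "(S - 6 + 2 * real_of_int f) / 6 * (- (1 / 62)) \<le> (S - 6 + 2 * real_of_int f) / 6 * (W - 4 * ln 2 - 2 * ln e)"
        using S f Delta_ge by (intro mult_left_mono) auto
      moreover have "real_of_int f * (693/1000) \<le> real_of_int f * ln 2"
        using f ln2_bounds by (intro mult_left_mono) auto
      ultimately show ?thesis unfolding eq1 eq2 using R Ue ln2_bounds S xx x f by argo
    qed
    show "0 \<le> (21 / 10 :: real)" "0 \<le> (225 / 1000 :: real)" by simp_all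
    show "1 / (1 + 21 / 10 + (21 / 10)\<^sup>2 / 2) + 1 / (1 + 225 / 1000 + (225 / 1000)\<^sup>2 / 2) < (1 :: real)"
      by (simp add: power2_eq_square)
  qed
qed

end

lemma small_not_power:
  fixes g p n :: nat
  assumes "2 \<le> g" "0 < p" "g ^ p = n" "17 \<le> n" "n \<le> 24"
  shows "p = 1"
proof (rule ccontr)
  assume "p \<noteq> 1"
  then have p: "2 \<le> p" using assms by simp
  have "g < 5"
  proof (rule ccontr)
    assume "\<not> g < 5"
    then have "5 ^ 2 \<le> g ^ 2" by (intro power_mono) auto
    also have "\<dots> \<le> g ^ p" using assms p by (intro power_increasing) auto
    finally show False using assms by simp
  qed
  moreover have "p < 5"
  proof (rule ccontr)
    assume "\<not> p < 5"
    then have "(2::nat) ^ 5 \<le> 2 ^ p" by (intro power_increasing) auto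
    also have "\<dots> \<le> g ^ p" using assms by (intro power_mono) auto
    finally show False using assms by simp
  qed
  ultimately have "g = 2 \<or> g = 3 \<or> g = 4" "p = 2 \<or> p = 3 \<or> p = 4" using p assms by auto
  then show False using assms by auto
qed

context close_powers
begin

text \<open>For \<open>e = 1\<close> the term \<open>ln e\<close> vanishes, and with
  \<open>J = - 1\<close> both exponents are governed by the single product
  \<open>(S - 8) * (W - 4 * ln 2)\<close>.\<close>

lemma adjacent_contradiction:
  assumes "e = 1" and R: "ln X + ln Y - 2 * W \<le> - (38/10)" and S: "28 \<le> S"
    and D: "7 \<le> (S - 8) * (W - 4 * ln 2)" "88/1000 \<le> W - 4 * ln 2" and x: "x \<le> 1 / 17"
  shows False
proof (rule contradictionI[where J = "- 1" and R = "- (38/10)" and ?f1.0 = "12/10" and ?f2.0 = "9/10"])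
  define z where "z = (S - 8) * (W - 4 * ln 2)"
  have z: "7 \<le> z" using D by (simp add: z_def)
  have zS: "(S - 8) * (88/1000) \<le> z" unfolding z_def using S D by (intro mult_left_mono) auto
  have xx: "S * x\<^sup>2 \<le> S / 289"
  proof -
    have "x\<^sup>2 \<le> (1 / 17)\<^sup>2" using x x_pos by (intro power_mono) auto
    then show ?thesis using S mult_left_mono[of "x\<^sup>2" "1/289" S] by (simp add: power_divide)
  qed
  show "ln X + ln Y - 2 * W \<le> - (38/10)" by (rule R)
  show "28 \<le> S" "- 1 \<le> (- 1 :: int)" "- S / 5 \<le> real_of_int (- 1)" using S by auto
  show "- (38/10) / 4 - (S + real_of_int (4 * - 1)) / 12 * (W - 4 * ln 2) - real_of_int (2 * (- 1 + 1)) * ln 2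
      + 16 / 100 * S * x\<^sup>2 + x + 1 / 10 \<le> - (12 / 10)"
  proof -
    have "(S + real_of_int (4 * - 1)) / 12 * (W - 4 * ln 2) = z / 12 + (W - 4 * ln 2) / 3"
      by (simp add: z_def field_simps)
    moreover have "real_of_int (2 * (- 1 + 1)) * ln 2 = 0" by simp
    ultimately show ?thesis using z zS xx x D(2) by argo
  qed
  show "- (38/10) / 2 + ln e + real_of_int (- 1 + 6) * ln 2 - 168 / 100
      - (S - real_of_int (2 * - 1) - 10) / 6 * (W - 4 * ln 2 - 2 * ln e)
      + 33 / 100 * S * x\<^sup>2 + 2 * x + 4 / 100 \<le> - (9 / 10)"
  proof -
    have "(S - real_of_int (2 * - 1) - 10) / 6 * (W - 4 * ln 2 - 2 * ln e) = z / 6" "ln e = 0"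
      using assms(1) by (simp_all add: z_def)
    moreover have "real_of_int (- 1 + 6) * ln 2 \<le> 5 * (6932/10000)" using ln2_bounds by simp
    ultimately show ?thesis using z zS xx x by argo
  qed
  show "0 \<le> (12 / 10 :: real)" "0 \<le> (9 / 10 :: real)" by simp_all
  show "1 / (1 + 12 / 10 + (12 / 10)\<^sup>2 / 2) + 1 / (1 + 9 / 10 + (9 / 10)\<^sup>2 / 2) < (1 :: real)"
    by (simp add: power2_eq_square)
qed

lemma x_adjacent:
  assumes "e = 1" "c \<le> u" "0 < c"
  shows "x \<le> 1 / c"
  using assms by (simp add: x_def frac_le)

lemma case_adjacent_large:
  assumes pr: "p = 1 \<or> r = 1" and "e = 1" "24 \<le> u"
  shows False
proof (rule adjacent_contradiction)
  have "24 ^ 7 \<le> u ^ 7" using assms by (intro power_mono) auto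
  then have "32 * ln 2 \<le> 7 * U" using ln2_mult_le[of 32 u 7] assms by (simp add: U_def)
  then have U: "32/7 * ln 2 \<le> U" by simp
  have V: "27/10 \<le> V" using U ln2_bounds L_bounds by (simp add: L_def)
  \<comment> \<open>Since \<open>15 / 24 < 633 / 1000\<close>, the length is at least 16.\<close>
  have S: "2875/100 \<le> S"
    using S_from_length[of "1/24" 16] x_adjacent[of 24] assms V by simp
  show "e = 1" by fact
  show "28 \<le> S" using S by simp
  show "ln X + ln Y - 2 * W \<le> - (38/10)" using R_le[OF pr] U ln2_bounds by argo
  show D: "88/1000 \<le> W - 4 * ln 2" using U ln2_bounds L_bounds by (simp add: W_eq)
  have "(2875/100 - 8) * (396/1000) \<le> (S - 8) * (W - 4 * ln 2)"
    using S U ln2_bounds L_bounds by (intro mult_mono) (auto simp: W_eq)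
  then show "7 \<le> (S - 8) * (W - 4 * ln 2)" by simp
  show "x \<le> 1 / 17" using x_adjacent[of 24] assms by simp
qed

lemma case_adjacent_small:
  assumes "e = 1" "17 \<le> u" "u \<le> 23"
  shows False
proof (rule adjacent_contradiction)
  have v: "v = u + 1" using assms by (simp add: e_def)
  have n: "17 \<le> g ^ p" "g ^ p \<le> 24" "17 \<le> h ^ r" "h ^ r \<le> 24"
  proof -
    have "real 17 \<le> real (g ^ p)" "real (g ^ p) \<le> real 24" "real (h ^ r) \<le> real 24"
      unfolding u_eq v_eq using assms v by simp_all
    then show "17 \<le> g ^ p" "g ^ p \<le> 24" "17 \<le> h ^ r" "h ^ r \<le> 24"
      using v17 by (simp_all only: of_nat_le_iff)
  qed
  \<comment> \<open>No proper power lies strictly between 16 and 25.\<close>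
  have p: "p = 1" and r: "r = 1"
    using small_not_power[OF g2 pos(1) refl n(1,2)] small_not_power[OF h2 pos(3) refl n(3,4)] by auto
  show x: "x \<le> 1 / 17" using x_adjacent[of 17] assms by simp
  have X: "ln X = 0" unfolding X_def using r by simp
  have Y: "ln Y = 0" unfolding Y_def using p by simp
  show "ln X + ln Y - 2 * W \<le> - (38/10)"
    using X Y U_ge ln2_bounds L_bounds by (simp add: W_eq)
  have "306 \<le> u * v" using mult_mono[of 17 u 18 v] assms v by simp
  then have "ln ((2 ^ 8) * (1 + 50/256)) \<le> ln (u * v)" using u_pos v by (subst ln_le_cancel_iff) auto
  moreover have "ln ((2 ^ 8) * (1 + 50/256 :: real)) = ln (2 ^ 8) + ln (1 + 50/256)" by (rule ln_mult_pos) auto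
  moreover have "ln ((2::real) ^ 8) = 8 * ln 2" by (simp only: ln_realpow of_nat_numeral)
  moreover have "50/256 - (50/256)\<^sup>2 / 2 \<le> ln (1 + 50/256 :: real)" by (rule ln_one_plus_ge_quadratic) simp
  moreover have "ln (u * v) = U + V" using u_pos v by (simp add: ln_mult_pos U_def V_def)
  moreover have "(50/256)\<^sup>2 \<le> (382/10000 :: real)" by (simp add: power2_eq_square)
  ultimately have "8 * ln 2 + 1762/10000 \<le> U + V" by linarith
  then have D: "881/10000 \<le> W - 4 * ln 2" unfolding W_def by argo
  then show "88/1000 \<le> W - 4 * ln 2" by simp
  \<comment> \<open>Now \<open>g\<close> is \<open>u\<close> itself, so \<open>s_lower\<close> works
    with \<open>4 * ln 2\<close> in place of \<open>ln 2\<close>.\<close>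
  have "U = ln g" unfolding U_eq using p by simp
  moreover have "r * \<eta> \<le> 6/100" using \<eta>_le r by simp
  ultimately have "U - 6/100 \<le> s * L" using s_lower by simp
  also have "\<dots> \<le> s * x" using L_bounds by (intro mult_left_mono) auto
  also have "\<dots> \<le> s * (1 / 17)" using x by (intro mult_left_mono) auto
  finally have s: "46 \<le> real s" using U_ge ln2_bounds by simp
  have "N2 = s" unfolding N2_def using r by simp
  then have S: "90 \<le> S" using S_ge s by simp
  then show "28 \<le> S" by simp
  have "(90 - 8) * (881/10000) \<le> (S - 8) * (W - 4 * ln 2)"
    using S D by (intro mult_mono) auto
  then show "7 \<le> (S - 8) * (W - 4 * ln 2)" by simp
  show "e = 1" by fact
qed

end

text \<open>The fractions 94/23 and 327/80 are neighbours in a Farey sequence and enclose the logarithm of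
  17 to base 2, so a fraction strictly between them has denominator at least 103.\<close>

lemma power_2_17_separated:
  fixes w s :: nat
  assumes s: "0 < s" "s < 103" and close: "\<bar>w * ln 2 - s * ln 17\<bar> \<le> \<eta>"
    and \<eta>: "\<eta> \<le> 6/100" "6 \<le> s \<Longrightarrow> \<eta> \<le> 1/10000"
  shows False
proof -
  have ln17: "ln (17::real) = 4 * ln 2 + ln (1 + 1/16)"
  proof -
    have "ln (2 ^ 4 * (1 + 1/16) :: real) = ln (2 ^ 4) + ln (1 + 1/16)" by (rule ln_mult_pos) auto
    moreover have "ln ((2::real) ^ 4) = 4 * ln 2" by (simp only: ln_realpow of_nat_numeral)
    ultimately show ?thesis by simp
  qed
  have l: "605/10000 \<le> ln (1 + 1/16 :: real)" "ln (1 + 1/16 :: real) \<le> 625/10000"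
    using ln_one_plus_ge_quadratic[of "1/16"] ln_add_one_self_le_self[of "1/16"]
    by (simp_all add: power2_eq_square)
  show False
  proof (cases "6 \<le> s")
    case False
    \<comment> \<open>For \<open>s \<le> 5\<close> the number \<open>s * ln (17 / 16)\<close> lies
      between 0.0605 and 0.3125, hence farther than 0.06 from every multiple of
      \<open>ln 2\<close>.\<close>
    define k where "k = real w - 4 * real s"
    have D: "real w * ln 2 - s * ln 17 = k * ln 2 - s * ln (1 + 1/16)"
      unfolding ln17 k_def by (simp add: algebra_simps)
    have s5: "1 \<le> real s" "real s \<le> 5" using False s by auto
    have sl: "1 * (605/10000) \<le> s * ln (1 + 1/16)" "s * ln (1 + 1/16) \<le> 5 * (625/10000)"
      using s5 l by (intro mult_mono; simp)+
    show False
    proof (cases "w \<le> 4 * s")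
      case True
      then have "k \<le> 0" unfolding k_def by linarith
      then have "k * ln 2 \<le> 0" using ln2_bounds by (intro mult_nonpos_nonneg) auto
      then show False using close D sl \<eta> by argo
    next
      case False
      then have "1 \<le> k" unfolding k_def by linarith
      then have "1 * ln 2 \<le> k * ln 2" using ln2_bounds by (intro mult_right_mono) auto
      then show False using close D sl \<eta> ln2_bounds by argo
    qed
  next
    case True
    have c1: "79/10000 \<le> 23 * ln 17 - 94 * ln (2::real)"
    proof -
      have "ln ((1 + 8/1000) * 2 ^ 94) \<le> ln ((17::real) ^ 23)" by (subst ln_le_cancel_iff) simp_all
      moreover have "ln ((1 + 8/1000) * 2 ^ 94 :: real) = ln (1 + 8/1000) + ln (2 ^ 94)" by (rule ln_mult_pos) auto
      moreover have "ln ((2::real) ^ 94) = 94 * ln 2" "ln ((17::real) ^ 23) = 23 * ln 17"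
        by (simp_all only: ln_realpow of_nat_numeral)
      moreover have "8/1000 - (8/1000)\<^sup>2/2 \<le> ln (1 + 8/1000 :: real)" by (rule ln_one_plus_ge_quadratic) simp
      moreover have "(8/1000)\<^sup>2 \<le> (1/10000 :: real)" by (simp add: power2_eq_square)
      ultimately show ?thesis by linarith
    qed
    have c2: "2/1000 \<le> 327 * ln 2 - 80 * ln (17::real)"
    proof -
      have "ln ((1 + 205/100000) * 17 ^ 80) \<le> ln ((2::real) ^ 327)" by (subst ln_le_cancel_iff) simp_all
      moreover have "ln ((1 + 205/100000) * 17 ^ 80 :: real) = ln (1 + 205/100000) + ln (17 ^ 80)" by (rule ln_mult_pos) auto
      moreover have "ln ((2::real) ^ 327) = 327 * ln 2" "ln ((17::real) ^ 80) = 80 * ln 17"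
        by (simp_all only: ln_realpow of_nat_numeral)
      moreover have "205/100000 - (205/100000)\<^sup>2/2 \<le> ln (1 + 205/100000 :: real)" by (rule ln_one_plus_ge_quadratic) simp
      moreover have "(205/100000)\<^sup>2 \<le> (1/100000 :: real)" by (simp add: power2_eq_square)
      ultimately show ?thesis by linarith
    qed
    \<comment> \<open>As \<open>23 * 327 - 80 * 94 = 1\<close>, these satisfy
      \<open>s = 23 * a + 80 * b\<close>, so both being positive would give
      \<open>s \<ge> 103\<close>. Otherwise \<open>w / s\<close> lies outside the open interval, and
      \<open>c1\<close> or \<open>c2\<close> measures how far it is from the logarithm.\<close>
    define a b where "a = 327 * int s - 80 * int w" and "b = 23 * int w - 94 * int s"
    have "int s = 23 * a + 80 * b" by (simp add: a_def b_def)
    then have "a \<le> 0 \<or> b \<le> 0" using s by linarith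
    then show False
    proof
      assume "a \<le> 0"
      then have "327 * real s \<le> 80 * real w" unfolding a_def by linarith
      then have "327 * real s * ln 2 \<le> 80 * real w * ln 2" using ln2_bounds by (intro mult_right_mono) auto
      moreover have "6 * (2/1000) \<le> s * (327 * ln 2 - 80 * ln 17)" using True c2 by (intro mult_mono) auto
      moreover have "s * (327 * ln 2 - 80 * ln 17) = 327 * real s * ln 2 - 80 * (s * ln 17)"
        "80 * (w * ln 2 - s * ln 17) = 80 * real w * ln 2 - 80 * (s * ln 17)" by (simp_all add: algebra_simps)
      ultimately have "6 * (2/1000) \<le> 80 * (w * ln 2 - s * ln 17)" by linarith
      then show False using close \<eta>(2)[OF True] by argo
    next
      assume "b \<le> 0"
      then have "23 * real w \<le> 94 * real s" unfolding b_def by linarith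
      then have "23 * real w * ln 2 \<le> 94 * real s * ln 2" using ln2_bounds by (intro mult_right_mono) auto
      moreover have "6 * (79/10000) \<le> s * (23 * ln 17 - 94 * ln 2)" using True c1 by (intro mult_mono) auto
      moreover have "s * (23 * ln 17 - 94 * ln 2) = 23 * (s * ln 17) - 94 * real s * ln 2"
        "23 * (s * ln 17 - w * ln 2) = 23 * (s * ln 17) - 23 * real w * ln 2" by (simp_all add: algebra_simps)
      ultimately have "6 * (79/10000) \<le> 23 * (s * ln 17 - w * ln 2)" by linarith
      then show False using close \<eta>(2)[OF True] by argo
    qed
  qed
qed

context close_powers
begin

lemma case_16_17:
  assumes "u = 16" "v = 17"
  shows False
proof -
  have gp: "g ^ p = 16" "h ^ r = 17"
    using assms unfolding u_eq[symmetric] v_eq[symmetric] by (metis of_nat_eq_iff of_nat_numeral)+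
  have r: "r = 1" using small_not_power[OF h2 pos(3) gp(2)] by simp
  then have h: "h = 17" using gp by simp
  obtain i where i: "g = 2 ^ i"
  proof -
    have "g dvd g ^ p" using pos by (intro dvd_power) auto
    then have "g dvd 2 ^ 4" using gp by simp
    then show ?thesis using that divides_primepow_nat[of 2 g 4] two_is_prime_nat by auto
  qed
  have e1: "e = 1" using assms by (simp add: e_def)
  have x: "x = 1 / 16" using assms by (simp add: x_def e_def)
  have Ueq: "U = 4 * ln 2"
  proof -
    have "U = ln (2 ^ 4)" using assms by (simp add: U_def)
    then show ?thesis by (simp only: ln_realpow of_nat_numeral)
  qed
  have L: "605/10000 \<le> L" using L_bounds(3) unfolding x by (simp add: power2_eq_square)
  \<comment> \<open>Here \<open>W - 4 * ln 2\<close> is only about 0.03, so \<open>S\<close> must be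
    far larger than \<open>s_lower\<close> yields for \<open>g = 2\<close>. The poor approximability
    of the logarithm of 17 to base 2 supplies the length.\<close>
  have s103: "103 \<le> s"
  proof (rule ccontr)
    assume "\<not> 103 \<le> s"
    then have "s < 103" by simp
    moreover have "\<bar>real (i * q) * ln 2 - s * ln 17\<bar> \<le> \<eta>"
      using ln_close i h by (simp add: ln_realpow mult.commute mult.left_commute)
    moreover have "\<eta> \<le> 1 / 10000" if "6 \<le> s"
    proof -
      have "4913\<^sup>2 \<le> (17::real) ^ 6" by simp
      also have "\<dots> \<le> 17 ^ s" using that by (intro power_increasing) auto
      also have "\<dots> \<le> M" unfolding M_def using h by simp
      finally have "4913 \<le> sqrt M" by (rule real_le_rsqrt)
      then have "4 / (15 * sqrt M) \<le> 4 / (15 * 4913)" using M32 by (intro divide_left_mono) auto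
      then show ?thesis unfolding \<eta>_def by simp
    qed
    ultimately show False using power_2_17_separated pos \<eta>_le by metis
  qed
  have "N2 = s" unfolding N2_def using r by simp
  then have S: "204 \<le> S" using S_ge s103 by simp
  have D: "3025/100000 \<le> W - 4 * ln 2" using L by (simp add: W_eq Ueq)
  have lX: "ln X = 0" unfolding X_def using r by simp
  have lg: "ln 2 \<le> ln (real g)" using g2 by auto
  show False
  proof (rule contradictionI[where J = "- 1" and R = "- 5 * ln 2" and ?f1.0 = "108/100" and ?f2.0 = "5/10"])
    show "ln X + ln Y - 2 * W \<le> - 5 * ln 2"
      using lX ln_Y lg L_bounds by (simp add: W_eq Ueq)
    show "28 \<le> S" "- 1 \<le> (- 1 :: int)" "- S / 5 \<le> real_of_int (- 1)" using S by auto
    have z: "(S - 8) * (3025/100000) \<le> (S - 8) * (W - 4 * ln 2)" using S D by (intro mult_left_mono) auto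
    have xx: "S * x\<^sup>2 = S / 256" unfolding x by (simp add: power_divide)
    show "- 5 * ln 2 / 4 - (S + real_of_int (4 * - 1)) / 12 * (W - 4 * ln 2) - real_of_int (2 * (- 1 + 1)) * ln 2
        + 16 / 100 * S * x\<^sup>2 + x + 1 / 10 \<le> - (108 / 100)"
    proof -
      have "(S + real_of_int (4 * - 1)) / 12 * (W - 4 * ln 2) = (S - 8) * (W - 4 * ln 2) / 12 + (W - 4 * ln 2) / 3"
        by (simp add: field_simps)
      moreover have "real_of_int (2 * (- 1 + 1)) * ln 2 = 0" by simp
      ultimately show ?thesis using z xx x D S ln2_bounds by argo
    qed
    show "- 5 * ln 2 / 2 + ln e + real_of_int (- 1 + 6) * ln 2 - 168 / 100
        - (S - real_of_int (2 * - 1) - 10) / 6 * (W - 4 * ln 2 - 2 * ln e)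
        + 33 / 100 * S * x\<^sup>2 + 2 * x + 4 / 100 \<le> - (5 / 10)"
    proof -
      have "(S - real_of_int (2 * - 1) - 10) / 6 * (W - 4 * ln 2 - 2 * ln e) = (S - 8) * (W - 4 * ln 2) / 6" "ln e = 0"
        using e1 by simp_all
      moreover have "real_of_int (- 1 + 6) * ln 2 = 5 * ln 2" by simp
      ultimately show ?thesis using z xx x S ln2_bounds by argo
    qed
    show "0 \<le> (108 / 100 :: real)" "0 \<le> (5 / 10 :: real)" by simp_all
    show "1 / (1 + 108 / 100 + (108 / 100)\<^sup>2 / 2) + 1 / (1 + 5 / 10 + (5 / 10)\<^sup>2 / 2) < (1 :: real)"
      by (simp add: power2_eq_square)
  qed
qed

lemma case_one_trivial_exponent:
  assumes "p = 1 \<or> r = 1"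
  shows False
proof (cases "e = 1")
  case False
  then show False using e_cases case_distant[OF assms] by blast
next
  case e: True
  have "g ^ p = 16 \<or> 17 \<le> g ^ p \<and> g ^ p \<le> 23 \<or> 24 \<le> g ^ p"
  proof -
    have "real 16 \<le> real (g ^ p)" unfolding u_eq using u16 by simp
    then have "16 \<le> g ^ p" by (simp only: of_nat_le_iff)
    then show ?thesis by linarith
  qed
  then have "u = 16 \<or> 17 \<le> u \<and> u \<le> 23 \<or> 24 \<le> u"
    unfolding u_eq[symmetric] by (metis of_nat_le_iff of_nat_numeral)
  then show False
    using case_16_17 case_adjacent_small case_adjacent_large assms e by (auto simp: e_def)
qed

end

section \<open>Two proper powers\<close>

text \<open>The squares up to \<open>37\<^sup>2\<close> and the higher powers below 14431.\<close>

definition small_powers :: "int list" where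
  "small_powers =
    [4, 8, 9, 16, 25, 27, 32, 36, 49, 64, 81, 100, 121, 125, 128, 144, 169, 196,
     216, 225, 243, 256, 289, 324, 343, 361, 400, 441, 484, 512, 529, 576, 625, 676, 729, 784,
     841, 900, 961, 1000, 1024, 1089, 1156, 1225, 1296, 1331, 1369, 1728, 2048, 2187, 2197, 2401, 2744, 3125,
     3375, 4096, 4913, 5832, 6561, 6859, 7776, 8000, 8192, 9261, 10000, 10648, 12167, 13824]"

text \<open>The single exception is the pair \<open>3 ^ 7\<close>, \<open>13 ^ 3\<close>, which is
  excluded in \<open>case_2187_2197\<close>.\<close>

lemma small_powers_close:
  "list_all (\<lambda>m. list_all (\<lambda>n. if n \<le> m then True else if n < 17 then True
     else if n \<le> 16 * (n - m) ^ 2 then True else m = 2187 \<and> n = 2197) small_powers) small_powers"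
  by code_simp

lemma higher_power_mem_small_powers:
  fixes g p :: nat
  assumes "2 \<le> g" "3 \<le> p" "g ^ p < 14431"
  shows "int (g ^ p) \<in> set small_powers"
proof -
  have "g < 25"
  proof (rule ccontr)
    assume "\<not> g < 25"
    then have "25 ^ 3 \<le> g ^ 3" by (intro power_mono) auto
    also have "\<dots> \<le> g ^ p" using assms by (intro power_increasing) auto
    finally show False using assms by simp
  qed
  moreover have "p < 14"
  proof (rule ccontr)
    assume "\<not> p < 14"
    then have "(2::nat) ^ 14 \<le> 2 ^ p" by (intro power_increasing) auto
    also have "\<dots> \<le> g ^ p" using assms by (intro power_mono) auto
    finally show False using assms by simp
  qed
  moreover have "list_all (\<lambda>p. list_all (\<lambda>g. g ^ p < (14431::int) \<longrightarrow> g ^ p \<in> set small_powers)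
      [2, 3, 4, 5, 6, 7, 8, 9, 10, 11, 12, 13, 14, 15, 16, 17, 18, 19, 20, 21, 22, 23, 24])
      [3, 4, 5, 6, 7, 8, 9, 10, 11, 12, 13]"
    by (simp only: list.pred_inject) (intro conjI TrueI; simp add: small_powers_def)
  moreover have "p \<in> set [3, 4, 5, 6, 7, 8, 9, 10, 11, 12, 13]"
    using assms \<open>p < 14\<close> by simp presburger
  moreover have "int g \<in> set [2, 3, 4, 5, 6, 7, 8, 9, 10, 11, 12, 13, 14, 15, 16, 17, 18, 19, 20, 21, 22, 23, 24]"
    using assms \<open>g < 25\<close> by simp presburger
  ultimately have "int g ^ p < 14431 \<longrightarrow> int g ^ p \<in> set small_powers"
    unfolding list_all_iff by blast
  moreover have "int g ^ p < 14431" using assms by (metis of_nat_less_iff of_nat_numeral of_nat_power)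
  ultimately show ?thesis by simp
qed

lemma square_mem_small_powers:
  fixes g :: nat
  assumes "2 \<le> g" "g \<le> 37"
  shows "int (g ^ 2) \<in> set small_powers"
proof -
  have "list_all (\<lambda>g. g ^ 2 \<in> set small_powers) (map int [2..<38])"
    by (simp add: small_powers_def upt_conv_Cons)
  moreover have "int g \<in> set (map int [2..<38])"
    unfolding set_map set_upt using assms by (intro imageI) auto
  ultimately have "int g ^ 2 \<in> set small_powers" unfolding list_all_iff by blast
  then show ?thesis by simp
qed

lemma ten_squares_le_power2:
  fixes r :: nat
  assumes "12 \<le> r"
  shows "10 * r\<^sup>2 \<le> 2 ^ r"
  using assms
proof (induction r rule: dec_induct)
  case (step n)
  have "2 * n + 1 \<le> 3 * n" using step by simp
  also have "\<dots> \<le> n * n" using step by (intro mult_right_mono) auto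
  finally have "10 * (Suc n)\<^sup>2 \<le> 20 * n\<^sup>2" by (simp add: power2_eq_square)
  then show ?case using step by simp
qed simp

lemma ln3_ge: "10972 / 10000 \<le> ln (3::real)"
  using ln2_mult_le[of 19 3 12] ln2_bounds by simp

section \<open>Lengths in terms of \<open>sqrt v\<close>, and the cases with two proper
  powers\<close>

context close_powers
begin

lemma v_pos: "0 < v" using h2 by (simp add: v_def)

lemma e_sqrt: "4 * e \<le> sqrt v" "e * (4 * sqrt v - 1) \<le> u"
proof -
  have "(4 * e)\<^sup>2 \<le> v" using v_ge by (simp add: power_mult_distrib)
  then show *: "4 * e \<le> sqrt v" by (rule real_le_rsqrt)
  have "4 * e * sqrt v \<le> sqrt v * sqrt v" using * v_def by (intro mult_right_mono) auto
  also have "\<dots> = v" by (simp add: v_def)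
  finally show "e * (4 * sqrt v - 1) \<le> u" by (simp add: e_def algebra_simps)
qed

lemma x_sqrt: "x * (4 * sqrt v - 1) \<le> 1"
  using e_sqrt(2) u_pos by (simp add: x_def divide_le_eq)

lemma x_le:
  assumes "1 \<le> z" "z \<le> sqrt v"
  shows "x \<le> 1 / (4 * z - 1)"
proof -
  have "x * (4 * z - 1) \<le> x * (4 * sqrt v - 1)" using assms x_pos by (intro mult_left_mono) auto
  then show ?thesis using x_sqrt assms by (simp add: le_divide_eq)
qed

lemma x_le147: "1369 \<le> v \<Longrightarrow> x \<le> 1 / 147"
  using x_le[of 37] real_le_rsqrt[of 37 v] by simp

text \<open>As \<open>h \<ge> 2\<close>, the exponent \<open>r\<close> is at most logarithmic in
  \<open>v\<close>, while \<open>M \<ge> 2 * u\<close> is of the size of \<open>v\<close>. This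
  makes \<open>s_lower\<close> available for \<open>r > 1\<close>.\<close>

lemma r_eta:
  assumes "1370 \<le> v"
  shows "r * \<eta> \<le> 6 / 100"
proof -
  have "10 * (real r)\<^sup>2 \<le> v"
  proof (cases "12 \<le> r")
    case True
    have "real (10 * r\<^sup>2) \<le> real (2 ^ r)" using ten_squares_le_power2[OF True] by (simp only: of_nat_le_iff)
    also have "\<dots> \<le> real (h ^ r)" using h2 by (simp add: power_mono)
    finally show ?thesis using v_eq by simp
  next
    case False
    then have "(real r)\<^sup>2 \<le> 11\<^sup>2" by (intro power_mono) auto
    then show ?thesis using assms by simp
  qed
  moreover have "v \<le> u * (148 / 147)"
  proof -
    have "u * x \<le> u * (1 / 147)" using x_le147 assms u_pos by (intro mult_left_mono) auto
    moreover have "u * x = e" using u_pos by (simp add: x_def)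
    ultimately show ?thesis by (simp add: e_def)
  qed
  ultimately have "160 * (10 * (real r)\<^sup>2) \<le> 81 * M" using M_u u_pos by argo
  then have "(40 * real r)\<^sup>2 \<le> 81 * M" unfolding power_mult_distrib by simp
  then have "(40 * real r)\<^sup>2 \<le> (9 * sqrt M)\<^sup>2" using M32 by (simp add: power_mult_distrib)
  then have "40 * real r \<le> 9 * sqrt M" by (rule power2_le_imp_le) (use M32 in simp)
  then show ?thesis using M32 by (simp add: \<eta>_def field_simps)
qed

text \<open>Combines \<open>s_lower\<close> with \<open>s \<le> r * (N2 + 1)\<close>,
  \<open>V = r * ln h\<close> and the bound \<open>x \<le> 1 / (4 * sqrt v - 1)\<close>. With a
  constant \<open>K\<close> the length \<open>S\<close> is thus at least of order
  \<open>sqrt v / ln v\<close>.\<close>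

lemma S_lower:
  assumes "1370 \<le> v" and K: "K \<le> (ln g - 6/100) * ln h" "0 \<le> K"
  shows "2 * K * (4 * sqrt v - 1) \<le> (S + 4) * V"
proof -
  have y: "37 \<le> sqrt v" using assms by (intro real_le_rsqrt) simp
  have "s = r * N2 + s mod r" by (simp add: N2_def)
  then have "s \<le> r * (N2 + 1)" using mod_less_divisor[OF pos(3), of s] by simp
  then have sN: "real s \<le> r * (real N2 + 1)" by (metis of_nat_1 of_nat_add of_nat_le_iff of_nat_mult)
  have "ln g - 6/100 \<le> s * L" by (rule s_lower[OF r_eta[OF assms(1)]])
  also have "\<dots> \<le> (r * (real N2 + 1)) * x" using sN L_bounds by (intro mult_mono) auto
  finally have "(ln g - 6/100) * ln h \<le> (r * (real N2 + 1)) * x * ln h"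
    using ln_h by (intro mult_right_mono) auto
  then have "K \<le> V * (real N2 + 1) * x" using K by (simp add: V_eq mult_ac)
  then have "K * (4 * sqrt v - 1) \<le> V * (real N2 + 1) * x * (4 * sqrt v - 1)"
    using y by (intro mult_right_mono) auto
  also have "\<dots> = V * (real N2 + 1) * (x * (4 * sqrt v - 1))" by simp
  also have "\<dots> \<le> V * (real N2 + 1) * 1" using x_sqrt UV_pos by (intro mult_left_mono) auto
  also have "\<dots> \<le> V * ((S + 4) / 2)"
    unfolding mult_1_right using S_ge UV_pos by (intro mult_left_mono) auto
  finally show ?thesis by (simp add: algebra_simps)
qed

lemma g_ne_h: "g \<noteq> h"
proof
  assume gh: "g = h"
  have "p < r" using lt g2 unfolding gh by (simp add: power_less_imp_less_exp)
  then have "h ^ Suc p \<le> h ^ r" using h2 by (intro power_increasing) auto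
  then have "2 * g ^ p \<le> h ^ r" using gh h2 by (metis mult_right_mono power_Suc order_trans zero_le)
  then have "real (2 * g ^ p) \<le> real (h ^ r)" by (simp only: of_nat_le_iff)
  then have "2 * u \<le> v" by (simp add: u_def v_def)
  then have "1 \<le> x" using u_pos by (simp add: x_def e_def)
  then show False using x_le16 by simp
qed

lemma ln_gh: "10972/10000 \<le> ln g \<or> 10972/10000 \<le> ln h"
proof -
  have "3 \<le> g \<or> 3 \<le> h" using g_ne_h g2 h2 by linarith
  then have "ln 3 \<le> ln (real g) \<or> ln 3 \<le> ln (real h)" by auto
  then show ?thesis using ln3_ge by auto
qed

text \<open>\<open>J\<close> is about \<open>- 6 - S / 20\<close>. This costs the first exponent a
  fifth of its length, whence \<open>8/10 * S - 24\<close> in \<open>A\<close>, and gives the second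
  a gain linear in \<open>S\<close>, which covers the loss from \<open>Delta_ge\<close> and lets
  \<open>ln e\<close> grow as in \<open>B\<close>.\<close>

lemma long_contradiction:
  assumes S: "60 \<le> S" and x: "x \<le> 1 / 100"
    and A: "911/100 + 694/10000 * S \<le> (8/10 * S - 24) / 12 * (W - 4 * ln 2)"
    and B: "ln e \<le> 165/100 + 316/10000 * S"
  shows False
proof -
  define n where "n = int N1 + int N2 - 2"
  have Sn: "S = real_of_int n" by (simp add: S_def n_def)
  define f where "f = n div 20"
  have f: "0 \<le> real_of_int f" "20 * real_of_int f \<le> S" "S \<le> 20 * real_of_int f + 19"
  proof -
    have "0 \<le> n" using S Sn by linarith
    then have "0 \<le> f" "20 * f \<le> n" "n \<le> 20 * f + 19" unfolding f_def by presburger+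
    then show "0 \<le> real_of_int f" "20 * real_of_int f \<le> S" "S \<le> 20 * real_of_int f + 19"
      unfolding Sn by linarith+
  qed
  have xx: "S * x\<^sup>2 \<le> S / 10000"
  proof -
    have "x\<^sup>2 \<le> (1 / 100)\<^sup>2" using x x_pos by (intro power_mono) auto
    then show ?thesis using S mult_left_mono[of "x\<^sup>2" "1/10000" S] by (simp add: power_divide)
  qed
  show False
  proof (rule contradictionI[where J = "- 6 - f" and R = "- (179/100)" and ?f1.0 = "25/10" and ?f2.0 = "2/10"])
    show "ln X + ln Y - 2 * W \<le> - (179/100)"
    proof -
      have "2 * W = U + V" by (simp add: W_def)
      then show ?thesis using ln_X ln_Y ln_gh ln_g ln_h by linarith
    qed
    show "28 \<le> S" "- 6 - f \<le> - 1" using S f by linarith+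
    show "- S / 5 \<le> real_of_int (- 6 - f)" using S f by simp
    show "- (179/100) / 4 - (S + real_of_int (4 * (- 6 - f))) / 12 * (W - 4 * ln 2) - real_of_int (2 * (- 6 - f + 1)) * ln 2
        + 16 / 100 * S * x\<^sup>2 + x + 1 / 10 \<le> - (25 / 10)"
    proof -
      have w: "0 \<le> W - 4 * ln 2" using U_ge L_bounds by (simp add: W_eq)
      have "(8/10 * S - 24) / 12 * (W - 4 * ln 2) \<le> (S + real_of_int (4 * (- 6 - f))) / 12 * (W - 4 * ln 2)"
        using w f S by (intro mult_right_mono) auto
      moreover have "real_of_int (2 * (- 6 - f + 1)) * ln 2 = - ((10 + 2 * real_of_int f) * ln 2)" by (simp add: algebra_simps)
      moreover have "(10 + 2 * real_of_int f) * ln 2 \<le> (10 + S / 10) * (6932/10000)"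
        using ln2_bounds f by (intro mult_mono) auto
      ultimately show ?thesis using A S xx x by argo
    qed
    show "- (179/100) / 2 + ln e + real_of_int (- 6 - f + 6) * ln 2 - 168 / 100
        - (S - real_of_int (2 * (- 6 - f)) - 10) / 6 * (W - 4 * ln 2 - 2 * ln e)
        + 33 / 100 * S * x\<^sup>2 + 2 * x + 4 / 100 \<le> - (2 / 10)"
    proof -
      have eq1: "S - real_of_int (2 * (- 6 - f)) - 10 = S + 2 + 2 * real_of_int f" by simp
      have eq2: "real_of_int (- 6 - f + 6) * ln 2 = - (real_of_int f * ln 2)" by (simp add: algebra_simps)
      have "(S + 2 + 2 * real_of_int f) / 6 * (- (1 / 62)) \<le> (S + 2 + 2 * real_of_int f) / 6 * (W - 4 * ln 2 - 2 * ln e)"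
        using S f Delta_ge by (intro mult_left_mono) auto
      moreover have "real_of_int f * (693/1000) \<le> real_of_int f * ln 2"
        using f ln2_bounds by (intro mult_left_mono) auto
      ultimately show ?thesis unfolding eq1 eq2 using B S xx x f by argo
    qed
    show "0 \<le> (25 / 10 :: real)" "0 \<le> (2 / 10 :: real)" by simp_all
    show "1 / (1 + 25 / 10 + (25 / 10)\<^sup>2 / 2) + 1 / (1 + 2 / 10 + (2 / 10)\<^sup>2 / 2) < (1 :: real)"
      by (simp add: power2_eq_square)
  qed
qed

text \<open>Condition \<open>A\<close> needs checking at \<open>S0\<close> only: for
  \<open>w \<ge> 1041/1000\<close> its right side has slope \<open>8/120 * w\<close>, at least the
  slope \<open>694/10000\<close> of the left side.\<close>

lemma long_contradiction':
  assumes S: "S0 \<le> S" "60 \<le> S0" and x: "x \<le> 1 / 100"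
    and w: "w \<le> W - 4 * ln 2" "1041/1000 \<le> w" and A: "911/100 + 694/10000 * S0 \<le> (8/10 * S0 - 24) / 12 * w"
    and B: "ln e \<le> 165/100 + 316/10000 * S"
  shows False
proof (rule long_contradiction)
  have "(S - S0) * (694/10000) \<le> (S - S0) * (8/120 * w)" using S w by (intro mult_left_mono) auto
  moreover have "(8/10 * S - 24) / 12 * w \<le> (8/10 * S - 24) / 12 * (W - 4 * ln 2)"
    using S w by (intro mult_left_mono) auto
  moreover have "(8/10 * S - 24) / 12 * w = (8/10 * S0 - 24) / 12 * w + (S - S0) * (8/120 * w)"
    by (simp add: field_simps)
  ultimately show "911/100 + 694/10000 * S \<le> (8/10 * S - 24) / 12 * (W - 4 * ln 2)"
    using A by argo
qed (use assms in auto)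

lemma ln_e_le: "ln e \<le> ln (sqrt v) - 2 * ln 2"
proof -
  have "ln (2 ^ 2 * e) \<le> ln (sqrt v)" using e_sqrt e_ge1 v_pos by (subst ln_le_cancel_iff) auto
  moreover have "ln (2 ^ 2 * e) = ln (2 ^ 2) + ln e" using e_ge1 by (intro ln_mult_pos) auto
  moreover have "ln ((2::real) ^ 2) = 2 * ln 2" by (simp only: ln_realpow of_nat_numeral)
  ultimately show ?thesis by linarith
qed

lemma V_sqrt: "V = 2 * ln (sqrt v)"
  using v_def h2 by (simp add: V_def ln_sqrt)

lemma case_large:
  assumes "14431 \<le> v"
  shows False
proof -
  define y where "y = sqrt v"
  \<comment> \<open>After this substitution \<open>ln y\<close> is bounded linearly in
    \<open>w\<close>, whereas \<open>S_lower\<close> is quadratic in \<open>w\<close>; the quotient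
    gives the linear bound for \<open>S\<close> that dominates \<open>ln e\<close>.\<close>
  define w where "w = sqrt (y / 120)"
  have y120: "120 \<le> y" unfolding y_def using assms by (intro real_le_rsqrt) simp
  have yw: "y = 120 * w\<^sup>2" using y120 by (simp add: w_def)
  have w1: "1 \<le> w" unfolding w_def using y120 by (intro real_le_rsqrt) simp
  have ww: "w \<le> w * w" using mult_left_mono[OF w1, of w] w1 by simp
  have t: "ln y \<le> 28524/10000 + 2 * w" "0 < ln y"
  proof -
    have "ln y = ln 120 + 2 * ln w" unfolding yw using w1 by (simp add: ln_mult ln_realpow)
    moreover have "ln w \<le> w - 1" using w1 by (intro ln_le_minus_one) auto
    moreover have "ln 120 \<le> ln ((2::real) ^ 7)" by (subst ln_le_cancel_iff) simp_all
    moreover have "ln ((2::real) ^ 7) = 7 * ln 2" by (simp only: ln_realpow of_nat_numeral)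
    ultimately show "ln y \<le> 28524/10000 + 2 * w" using ln2_bounds by linarith
    show "0 < ln y" using y120 by simp
  qed
  have K: "69/100 \<le> (ln g - 6/100) * ln h"
    using ln_gh
  proof
    assume "10972/10000 \<le> ln g"
    then have "(10372/10000) * (693/1000) \<le> (ln g - 6/100) * ln h" using ln_h by (intro mult_mono) auto
    then show ?thesis by simp
  next
    assume "10972/10000 \<le> ln h"
    then have "(633/1000) * (10972/10000) \<le> (ln g - 6/100) * ln h" using ln_g by (intro mult_mono) auto
    then show ?thesis by simp
  qed
  have "2 * (69/100) * (4 * y - 1) \<le> (S + 4) * V"
    unfolding y_def using S_lower[OF _ K] assms by simp
  then have St: "69/100 * (480 * (w * w) - 1) \<le> (S + 4) * ln y"
    unfolding V_sqrt y_def[symmetric] by (simp add: yw power2_eq_square algebra_simps)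
  have S: "60 \<le> S"
  proof (rule ccontr)
    assume "\<not> 60 \<le> S"
    then have "(S + 4) * ln y \<le> 64 * ln y" using t by (intro mult_right_mono) auto
    also have "\<dots> \<le> 64 * (28524/10000 + 2 * w)" using t by simp
    finally show False using St ww w1 by argo
  qed
  have S': "634/10 * w - 58/10 \<le> S"
  proof (rule ccontr)
    assume "\<not> 634/10 * w - 58/10 \<le> S"
    then have "(S + 4) * ln y \<le> (634/10 * w - 18/10) * (28524/10000 + 2 * w)"
      using t S w1 by (intro mult_mono) auto
    also have "\<dots> = 634/5 * (w * w) + (634/10 * (28524/10000) - 36/10) * w - 18/10 * (28524/10000)"
      by (simp add: field_simps)
    finally show False using St ww w1 by argo
  qed
  have x: "x \<le> 1 / 479" using x_le[of 120] y120 by (simp add: y_def)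
  have V: "69 * ln 2 \<le> 5 * V"
  proof -
    have "14431 ^ 5 \<le> v ^ 5" using assms by (intro power_mono) auto
    then have "real 69 * ln 2 \<le> real 5 * ln v" by (intro ln2_mult_le) (use assms in auto)
    then show ?thesis by (simp add: V_def)
  qed
  show False
  proof (rule long_contradiction'[of 60 "6785/1000"])
    show "60 \<le> S" "60 \<le> (60::real)" by (fact S) simp
    show "x \<le> 1 / 100" using x by simp
    show "6785/1000 \<le> W - 4 * ln 2" using V x L_bounds ln2_bounds unfolding W_def L_def by argo
    show "ln e \<le> 165/100 + 316/10000 * S"
      using ln_e_le t S' w1 ln2_bounds unfolding y_def[symmetric] by argo
  qed simp_all
qed

lemma case_square:
  assumes "1370 \<le> v" and "p = 2 \<or> r = 2"
  shows False
proof -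
  define y where "y = sqrt v"
  have y37: "37 \<le> y" unfolding y_def using assms by (intro real_le_rsqrt) simp
  have x: "x \<le> 1 / 147" using x_le147 assms by simp
  have V: "52 * ln 2 \<le> 5 * V"
  proof -
    have "1370 ^ 5 \<le> v ^ 5" using assms by (intro power_mono) auto
    then have "real 52 * ln 2 \<le> real 5 * ln v" by (intro ln2_mult_le) (use assms in auto)
    then show ?thesis by (simp add: V_def)
  qed
  \<comment> \<open>A base that is the square root of \<open>u\<close> or \<open>v\<close> makes
    \<open>K\<close> proportional to \<open>V\<close>. Then \<open>V\<close> cancels in
    \<open>S_lower\<close> and \<open>S\<close> is of order \<open>sqrt v\<close>, so a smaller
    bound on \<open>v\<close> suffices than in \<open>case_large\<close>.\<close>
  have K: "31/100 * V \<le> (ln g - 6/100) * ln h"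
    using assms(2)
  proof
    assume "p = 2"
    then have "ln g = U / 2" unfolding U_eq by simp
    then have "(U / 2 - 6/100) * (693/1000) \<le> (ln g - 6/100) * ln h"
      using ln_h ln_g by (intro mult_mono) auto
    then show ?thesis using V x L_bounds ln2_bounds unfolding L_def by argo
  next
    assume "r = 2"
    then have "ln h = V / 2" unfolding V_eq by simp
    then have "(633/1000) * (V / 2) \<le> (ln g - 6/100) * ln h"
      using ln_h ln_g by (intro mult_mono) auto
    then show ?thesis using UV_pos by argo
  qed
  have "2 * (31/100 * V) * (4 * y - 1) \<le> (S + 4) * V"
    unfolding y_def using S_lower[OF assms(1) K] UV_pos by simp
  then have "(62/100 * (4 * y - 1)) * V \<le> (S + 4) * V" by (simp add: algebra_simps)
  then have S: "62/100 * (4 * y - 1) \<le> S + 4" using UV_pos by (subst (asm) mult_le_cancel_right_pos) auto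
  have ly: "ln y \<le> 5 * ln 2 + y / 32 - 1"
  proof -
    have "ln (2 ^ 5 * (y / 32)) = ln (2 ^ 5) + ln (y / 32)" using y37 by (intro ln_mult_pos) auto
    moreover have "ln ((2::real) ^ 5) = 5 * ln 2" by (simp only: ln_realpow of_nat_numeral)
    moreover have "ln (y / 32) \<le> y / 32 - 1" using y37 by (intro ln_le_minus_one) auto
    ultimately show ?thesis by simp
  qed
  show False
  proof (rule long_contradiction'[of 87 "442/100"])
    show "87 \<le> S" using S y37 by argo
    show "x \<le> 1 / 100" using x by simp
    show "442/100 \<le> W - 4 * ln 2" using V x L_bounds ln2_bounds unfolding W_def L_def by argo
    show "ln e \<le> 165/100 + 316/10000 * S"
      using ln_e_le ly S y37 ln2_bounds unfolding y_def[symmetric] by argo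
  qed simp_all
qed

text \<open>Factorisation gives \<open>g \<ge> 3\<close> and \<open>h \<ge> 13\<close>; the product
  of their logarithms is large enough for \<open>S_lower\<close> to force
  \<open>S \<ge> 100\<close>.\<close>

lemma case_2187_2197:
  assumes "g ^ p = 2187" "h ^ r = 2197"
  shows False
proof -
  have u: "u = 2187" "v = 2197" using assms u_eq v_eq by simp_all
  have "odd g" using assms(1) pos by (metis dvd_power_same even_power odd_numeral)
  then have "3 \<le> g" using g2 by (cases "g = 2") auto
  then have g: "10972/10000 \<le> ln (real g)"
    using ln3_ge ln_le_cancel_iff[of 3 "real g"] by linarith
  obtain P where P: "prime P" "P dvd h" using h2 prime_factor_nat[of h] by auto
  have "P dvd h ^ r" using P pos by (meson dvd_power dvd_trans)
  then have "P dvd 13 ^ 3" using assms by simp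
  then have "P dvd 13" using P prime_dvd_power by blast
  moreover have "prime (13::nat)" by (simp add: prime_nat_numeral_eq)
  ultimately have "P = 13" using P primes_dvd_imp_eq by blast
  then have "13 \<le> h" using P h2 by (intro dvd_imp_le) auto
  then have "ln 13 \<le> ln (real h)" by simp
  moreover have "7 * ln 2 \<le> 2 * ln (13::real)" using ln2_mult_le[of 7 13 2] by simp
  ultimately have h: "24/10 \<le> ln h" using ln2_bounds by argo
  have "(1037/1000) * (24/10) \<le> (ln g - 6/100) * ln h" using g h by (intro mult_mono) auto
  then have K: "24/10 \<le> (ln g - 6/100) * ln h" by simp
  have y: "46 \<le> sqrt v" unfolding u by (intro real_le_rsqrt) simp
  have "2 * (24/10) * (4 * 46 - 1) \<le> 2 * (24/10) * (4 * sqrt v - 1)" using y by simp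
  also have "\<dots> \<le> (S + 4) * V" using S_lower[OF _ K] u by simp
  finally have "2 * (24/10) * (4 * 46 - 1) \<le> (S + 4) * V" .
  moreover have V: "V \<le> 84/10"
  proof -
    have "V \<le> ln (2 ^ 12)" unfolding V_def u by (subst ln_le_cancel_iff) auto
    then show ?thesis using ln2_bounds unfolding ln_realpow by simp
  qed
  then have "(S + 4) * V \<le> (S + 4) * (84/10)" if "S < 100"
    using S_ge by (intro mult_left_mono) auto
  ultimately have S: "100 \<le> S" by argo
  have U: "11 * ln 2 \<le> U" using ln2_mult_le[of 11 u 1] u by (simp add: U_def)
  show False
  proof (rule long_contradiction'[of 100 "48/10"])
    show "100 \<le> S" by fact
    show "x \<le> 1 / 100" by (simp add: x_def e_def u)
    show "48/10 \<le> W - 4 * ln 2" using U ln2_bounds L_bounds by (simp add: W_eq)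
    have "e = 10" by (simp add: e_def u)
    moreover have "ln (10::real) \<le> ln (2 ^ 4)" by (subst ln_le_cancel_iff) auto
    then have "ln (10::real) \<le> 4 * ln 2" by (simp only: ln_realpow of_nat_numeral)
    ultimately show "ln e \<le> 165/100 + 316/10000 * S" using S ln2_bounds by simp
  qed simp_all
qed

lemma contradiction: False
proof (cases "p = 1 \<or> r = 1")
  case True
  then show False by (rule case_one_trivial_exponent)
next
  case False
  then have p2: "2 \<le> p" "2 \<le> r" using pos by auto
  \<comment> \<open>Squares are treated analytically from 1370 on, so in the third case both powers
    occur in \<open>small_powers\<close>.\<close>
  consider "14431 \<le> v" | "1370 \<le> v" "p = 2 \<or> r = 2" | "h ^ r < 14431" "h ^ r < 1370 \<or> 3 \<le> p \<and> 3 \<le> r"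
  proof -
    have "14431 \<le> v \<or> h ^ r < 14431" "1370 \<le> v \<or> h ^ r < 1370"
      unfolding v_eq[symmetric] by linarith+
    then show thesis using that p2 by linarith
  qed
  then show False
  proof cases
    case 3
    have small: "int (b ^ n) \<in> set small_powers"
      if "2 \<le> b" "2 \<le> n" "b ^ n < 14431" "b ^ n < 1370 \<or> 3 \<le> n" for b n :: nat
    proof (cases "3 \<le> n")
      case True
      then show ?thesis using that higher_power_mem_small_powers by blast
    next
      case False
      then have n: "n = 2" using that by simp
      have "b \<le> 37"
      proof (rule ccontr)
        assume "\<not> b \<le> 37"
        then have "38\<^sup>2 \<le> b\<^sup>2" by (intro power_mono) auto
        then show False using that n by simp
      qed
      then show ?thesis using that n square_mem_small_powers by blast
    qed
    have m: "int (g ^ p) \<in> set small_powers" and n: "int (h ^ r) \<in> set small_powers"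
      using small[OF g2 p2(1)] small[OF h2 p2(2)] 3 lt by auto
    have cl: "16 * (int (h ^ r) - int (g ^ p))\<^sup>2 < int (h ^ r)"
    proof -
      have "real_of_int (16 * (int (h ^ r) - int (g ^ p))\<^sup>2) < real_of_int (int (h ^ r))"
        using close by simp
      then show ?thesis by (simp only: of_int_less_iff)
    qed
    have "\<not> int (h ^ r) \<le> int (g ^ p)" "\<not> int (h ^ r) < 17"
      using lt v17 by (simp_all del: of_nat_power)
    then have "int (g ^ p) = 2187 \<and> int (h ^ r) = 2197"
      using small_powers_close m n cl unfolding list_all_iff by (metis not_le)
    then have "g ^ p = 2187" "h ^ r = 2197" by linarith+
    then show False by (rule case_2187_2197)
  qed (use case_large case_square in auto)
qed

end

section \<open>Multiplicative dependence\<close>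

text \<open>Division by the gcd leaves \<open>a ^ q = b ^ p\<close> with coprime exponents. For each
  prime, \<open>p\<close> divides \<open>q\<close> times its multiplicity in \<open>a\<close>, hence
  the multiplicity itself; so \<open>a\<close> is a \<open>p\<close>-th power, and its root serves
  for \<open>b\<close> as well.\<close>

lemma common_base:
  fixes a b k l :: nat
  assumes "a ^ k = b ^ l" "0 < k" "0 < l" "1 < a" "1 < b"
  obtains g p q where "2 \<le> g" "0 < p" "0 < q" "coprime p q" "a = g ^ p" "b = g ^ q"
proof -
  define d where "d = gcd k l"
  define q p where "q = k div d" and "p = l div d"
  have d: "0 < d" using assms by (simp add: d_def)
  have kl: "k = q * d" "l = p * d" by (simp_all add: q_def p_def d_def)
  have pq: "0 < p" "0 < q" using kl assms by (auto intro: Nat.gr0I)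
  have cop: "coprime q p" using assms unfolding q_def p_def d_def by (intro div_gcd_coprime) auto
  have "(a ^ q) ^ d = (b ^ p) ^ d" using assms kl by (simp flip: power_mult)
  then have eq: "a ^ q = b ^ p" using d by (simp add: power_eq_iff_eq_base)
  have "is_nth_power p a"
    unfolding is_nth_power_conv_multiplicity_nat[OF pq(1)]
  proof (intro allI impI)
    fix P :: nat assume P: "prime P"
    have "q * multiplicity P a = multiplicity P (a ^ q)"
      using P assms by (simp add: prime_elem_multiplicity_power_distrib)
    also have "\<dots> = p * multiplicity P b"
      unfolding eq using P assms by (simp add: prime_elem_multiplicity_power_distrib)
    finally have "p dvd q * multiplicity P a" by simp
    then show "p dvd multiplicity P a" using cop by (simp add: coprime_commute coprime_dvd_mult_right_iff)
  qed
  then obtain g where g: "a = g ^ p" by (elim is_nth_powerE)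
  have "(g ^ q) ^ p = b ^ p" using eq unfolding g by (simp add: mult.commute flip: power_mult)
  then have b: "b = g ^ q" using pq by (simp add: power_eq_iff_eq_base)
  have "g \<noteq> 0"
  proof
    assume "g = 0"
    then have "a = 0" using g pq by simp
    then show False using assms(4) by simp
  qed
  moreover have "g \<noteq> 1" using g assms(4) by auto
  ultimately have "2 \<le> g" by simp
  moreover have "coprime p q" using cop by (simp add: coprime_commute)
  ultimately show ?thesis using that pq g b by blast
qed

text \<open>Taking logarithms gives \<open>k * ln a + l * ln b = 0\<close> with positive logarithms.
  So \<open>k\<close> and \<open>l\<close> are both nonzero, of opposite sign, and their absolute
  values satisfy the relation required by \<open>common_base\<close>.\<close>

lemma mult_dependent_common_base:
  fixes a b :: int
  assumes "mult_dependent [of_int a, of_int b]" "1 < a" "1 < b"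
  obtains g p q where "2 \<le> g" "0 < p" "0 < q" "coprime p q" "a = int (g ^ p)" "b = int (g ^ q)"
proof -
  define zs :: "complex list" where "zs = [of_int a, of_int b]"
  have "\<exists>ks :: int list. length ks = length zs \<and> (\<exists>i<length zs. ks ! i \<noteq> 0) \<and>
      (\<Prod>i<length zs. (zs ! i) powi (ks ! i)) = 1"
    using assms(1) unfolding mult_dependent_def zs_def .
  then obtain ks :: "int list" where "length ks = length zs \<and> (\<exists>i<length zs. ks ! i \<noteq> 0) \<and>
      (\<Prod>i<length zs. (zs ! i) powi (ks ! i)) = 1" ..
  then have ks: "\<exists>i<length zs. ks ! i \<noteq> 0" "(\<Prod>i<length zs. (zs ! i) powi (ks ! i)) = 1"
    by simp_all
  define k l where "k = ks ! 0" and "l = ks ! 1"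
  have "(of_int a :: complex) powi k * of_int b powi l = 1"
    using ks(2) by (simp add: zs_def k_def l_def lessThan_Suc mult.commute)
  then have "complex_of_real (of_int a powi k * of_int b powi l) = complex_of_real 1"
    by (simp add: of_real_power_int)
  then have "(of_int a :: real) powi k * of_int b powi l = 1"
    by (simp only: of_real_eq_iff)
  moreover have ln_powi: "ln (z powi n) = of_int n * ln z" if "0 < z" for z :: real and n
    using that by (simp add: ln_powr powr_real_of_int' flip: powr_real_of_int')
  ultimately have "of_int k * ln (real_of_int a) + of_int l * ln (real_of_int b) = 0"
    using assms ln_mult_pos[of "of_int a powi k" "of_int b powi l"] by (simp add: zero_less_power_int)
  moreover have pos: "0 < ln (real_of_int a)" "0 < ln (real_of_int b)" using assms by auto
  ultimately have rel: "of_int k * ln (real_of_int a) = of_int (- l) * ln (real_of_int b)" by simp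
  have "k \<noteq> 0 \<or> l \<noteq> 0" using ks(1) unfolding k_def l_def zs_def by (auto simp: less_Suc_eq)
  then have nz: "k \<noteq> 0" "l \<noteq> 0" using rel pos by auto
  have abs: "real (nat \<bar>k\<bar>) * ln (real_of_int a) = real (nat \<bar>l\<bar>) * ln (real_of_int b)"
  proof -
    have "\<bar>of_int k * ln (real_of_int a)\<bar> = \<bar>of_int (- l) * ln (real_of_int b)\<bar>" using rel by simp
    then show ?thesis using pos by (simp add: abs_mult)
  qed
  have "ln (real (nat a ^ nat \<bar>k\<bar>)) = ln (real (nat b ^ nat \<bar>l\<bar>))"
    using abs assms by (simp add: ln_realpow)
  then have "real (nat a ^ nat \<bar>k\<bar>) = real (nat b ^ nat \<bar>l\<bar>)"
    using assms by (subst (asm) ln_inj_iff) auto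
  then have "nat a ^ nat \<bar>k\<bar> = nat b ^ nat \<bar>l\<bar>" by (simp only: of_nat_eq_iff)
  then obtain g p q where "2 \<le> g" "0 < p" "0 < q" "coprime p q" "nat a = g ^ p" "nat b = g ^ q"
    using nz assms by (elim common_base) auto
  then show ?thesis using that assms by (metis nat_0_le order_less_imp_le zero_less_one less_trans)
qed

lemma coprime_ratio_eq:
  fixes p q r s :: nat
  assumes "p * s = q * r" "coprime p q" "coprime r s" "0 < p" "0 < r"
  shows "p = r" "q = s"
proof -
  have "p dvd q * r" "r dvd p * s" using assms(1) by (metis dvd_triv_left, metis dvd_triv_right)
  then have "p dvd r" "r dvd p"
    using coprime_dvd_mult_right_iff[OF assms(2)] coprime_dvd_mult_left_iff[OF assms(3)] by blast+
  then show "p = r" by (rule dvd_antisym)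
  then show "q = s" using assms by simp
qed

lemma power_gap:
  fixes g h q :: nat
  assumes "g \<noteq> h" "0 < q"
  shows "int (g ^ (q - 1)) \<le> \<bar>int (h ^ q) - int (g ^ q)\<bar>"
proof -
  have q: "g ^ q = g * g ^ (q - 1)" "h ^ q = h * h ^ (q - 1)" using assms by (simp_all add: power_eq_if)
  show ?thesis
  proof (cases "g < h")
    case True
    then have "Suc g * g ^ (q - 1) \<le> h * h ^ (q - 1)" by (intro mult_mono power_mono) auto
    then have "g ^ (q - 1) + g ^ q \<le> h ^ q" using q by simp
    then have "int (g ^ (q - 1)) + int (g ^ q) \<le> int (h ^ q)" by (simp only: of_nat_add[symmetric] of_nat_le_iff)
    then show ?thesis by simp
  next
    case False
    then have "Suc h \<le> g" using assms by simp
    have "h * h ^ (q - 1) \<le> h * g ^ (q - 1)" using False by (intro mult_left_mono power_mono) auto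
    then have "g ^ (q - 1) + h ^ q \<le> Suc h * g ^ (q - 1)" using q by simp
    also have "\<dots> \<le> g ^ q" unfolding q using \<open>Suc h \<le> g\<close> by (intro mult_right_mono) auto
    finally have "int (g ^ (q - 1)) + int (h ^ q) \<le> int (g ^ q)" by (simp only: of_nat_add[symmetric] of_nat_le_iff)
    then show ?thesis by simp
  qed
qed

theorem theorem2p2:
  fixes a b \<epsilon> \<delta> :: int
  assumes "1 < a" and "a < b"
    and "mult_dependent [of_int a, of_int b]"
    and "0 < \<bar>\<epsilon>\<bar>" and "real_of_int \<bar>\<epsilon>\<bar> < 1 / 4 * sqrt (real_of_int a)"
    and "0 < \<bar>\<delta>\<bar>" and "real_of_int \<bar>\<delta>\<bar> < 1 / 4 * sqrt (real_of_int b)"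
  shows "mult_independent [of_int (a + \<epsilon>), of_int (b + \<delta>)]"
  unfolding mult_independent_def
proof
  assume dep: "mult_dependent [of_int (a + \<epsilon>), of_int (b + \<delta>)]"
  have square: "16 * d\<^sup>2 < c" if "real_of_int \<bar>d\<bar> < 1 / 4 * sqrt (real_of_int c)" "1 < c" for c d :: int
  proof -
    have "(4 * real_of_int \<bar>d\<bar>)\<^sup>2 < (sqrt (real_of_int c))\<^sup>2"
      using that by (intro power_strict_mono) auto
    then have "real_of_int (16 * d\<^sup>2) < real_of_int c" using that by (simp add: power_mult_distrib)
    then show ?thesis by (simp only: of_int_less_iff)
  qed
  have \<epsilon>: "16 * \<epsilon>\<^sup>2 < a" and \<delta>: "16 * \<delta>\<^sup>2 < b" using square assms by auto
  have abs_le: "\<bar>d\<bar> \<le> d\<^sup>2" for d :: int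
    using self_le_power[of "\<bar>d\<bar>" 2] by (cases "d = 0") auto
  have gt1: "1 < a + \<epsilon>" "1 < b + \<delta>" "17 \<le> a"
    using \<epsilon> \<delta> abs_le[of \<epsilon>] abs_le[of \<delta>] assms by linarith+
  obtain g p q where g: "2 \<le> g" and pq: "0 < p" "0 < q" "coprime p q" and ab: "a = int (g ^ p)" "b = int (g ^ q)"
    using mult_dependent_common_base[OF assms(3)] assms by auto
  obtain h r s where h: "2 \<le> h" and rs: "0 < r" "0 < s" "coprime r s"
    and hab: "a + \<epsilon> = int (h ^ r)" "b + \<delta> = int (h ^ s)"
    using mult_dependent_common_base[OF dep] gt1 by auto
  have "g ^ p < g ^ q" using assms(2) unfolding ab by (simp only: of_nat_less_iff)
  then have "p < q" using g by (simp add: power_less_imp_less_exp)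
  have "int (g ^ p) \<noteq> int (h ^ r)" "int (g ^ q) \<noteq> int (h ^ s)"
    unfolding ab[symmetric] hab[symmetric] using assms(4,6) by simp_all
  then have gh: "g ^ p \<noteq> h ^ r" "g ^ q \<noteq> h ^ s" by metis+
  \<comment> \<open>Equal ratios of coprime exponents mean equal exponents. Then
    \<open>\<bar>\<delta>\<bar>\<close> is at least \<open>g ^ (q - 1)\<close>, whose square is at
    least \<open>b = g ^ q\<close> because \<open>q \<ge> 2\<close>; this contradicts the bound on
    \<open>\<delta>\<close>.\<close>
  have ratio: "p * s \<noteq> q * r"
  proof
    assume "p * s = q * r"
    then have "p = r" "q = s" using coprime_ratio_eq pq rs by blast+
    then have "g \<noteq> h" using gh by auto
    then have "int (g ^ (q - 1)) \<le> \<bar>\<delta>\<bar>"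
      using power_gap[of g h q] pq hab ab \<open>q = s\<close> by simp
    then have "(int (g ^ (q - 1)))\<^sup>2 \<le> \<bar>\<delta>\<bar>\<^sup>2" by (intro power_mono) auto
    moreover have "int (g ^ q) \<le> (int (g ^ (q - 1)))\<^sup>2"
    proof -
      have "g ^ q \<le> g ^ ((q - 1) * 2)" using g \<open>p < q\<close> pq by (intro power_increasing) auto
      then have "int (g ^ q) \<le> int (g ^ ((q - 1) * 2))" by (simp only: of_nat_le_iff)
      then show ?thesis by (simp add: power_mult)
    qed
    ultimately show False using \<delta> zero_le_power2[of \<delta>] unfolding ab power2_abs by linarith
  qed
  have "2 * g ^ p \<le> g * g ^ p" using g by simp
  also have "\<dots> \<le> g ^ q" using g \<open>p < q\<close> power_increasing[of "Suc p" q g] by simp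
  finally have "real (2 * g ^ p) \<le> real (g ^ q)" by (simp only: of_nat_le_iff)
  then have large: "2 * real (g ^ p) \<le> real (g ^ q)" by simp
  have re: "real (h ^ r) - real (g ^ p) = of_int \<epsilon>" "real (h ^ s) - real (g ^ q) = of_int \<delta>"
  proof -
    have "real_of_int (int (h ^ r)) - real_of_int (int (g ^ p)) = of_int \<epsilon>"
      "real_of_int (int (h ^ s)) - real_of_int (int (g ^ q)) = of_int \<delta>"
      unfolding ab[symmetric] hab[symmetric] by simp_all
    then show "real (h ^ r) - real (g ^ p) = of_int \<epsilon>" "real (h ^ s) - real (g ^ q) = of_int \<delta>"
      by (simp_all only: of_int_of_nat_eq)
  qed
  have r\<epsilon>: "16 * (real_of_int \<epsilon>)\<^sup>2 < real (g ^ p)" and r\<delta>: "16 * (real_of_int \<delta>)\<^sup>2 < real (g ^ q)"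
  proof -
    have "real_of_int (16 * \<epsilon>\<^sup>2) < real_of_int (int (g ^ p))" "real_of_int (16 * \<delta>\<^sup>2) < real_of_int (int (g ^ q))"
      using \<epsilon> \<delta> unfolding ab by (simp_all only: of_int_less_iff)
    then show "16 * (real_of_int \<epsilon>)\<^sup>2 < real (g ^ p)" "16 * (real_of_int \<delta>)\<^sup>2 < real (g ^ q)"
      by simp_all
  qed
  have g17: "17 \<le> g ^ p" using gt1(3) unfolding ab by linarith
  show False
  proof (cases "0 < \<epsilon>")
    case True
    then have "int (g ^ p) < int (h ^ r)" using ab hab by simp
    then have lt: "g ^ p < h ^ r" by (simp only: of_nat_less_iff)
    have "close_powers g h p q r s"
    proof
      have "real (g ^ p) < real (h ^ r)" using lt by (simp only: of_nat_less_iff)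
      then show "16 * (real (h ^ r) - real (g ^ p))\<^sup>2 < real (h ^ r)" unfolding re using r\<epsilon> by linarith
      show "16 * (real (h ^ s) - real (g ^ q))\<^sup>2 < max (real (h ^ s)) (real (g ^ q))"
        unfolding re using r\<delta> by linarith
      show "2 * real (g ^ p) \<le> max (real (h ^ s)) (real (g ^ q))" using large by linarith
    qed (use g h pq rs lt g17 gh ratio in auto)
    then show False by (rule close_powers.contradiction)
  next
    case False
    then have "int (h ^ r) < int (g ^ p)" using ab hab assms(4) by simp
    then have lt: "h ^ r < g ^ p" by (simp only: of_nat_less_iff)
    \<comment> \<open>Here \<open>\<epsilon>\<close> is negative, so \<open>a\<close> itself plays
      the part of \<open>v\<close>.\<close>
    have "close_powers h g r s p q"
    proof
      have "real (h ^ r) < real (g ^ p)" using lt by (simp only: of_nat_less_iff)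
      then show "2 * real (h ^ r) \<le> max (real (g ^ q)) (real (h ^ s))" using large by linarith
      show "16 * (real (g ^ p) - real (h ^ r))\<^sup>2 < real (g ^ p)"
        using r\<epsilon> unfolding re[symmetric] by (simp only: power2_commute)
      have "16 * (real (h ^ s) - real (g ^ q))\<^sup>2 < max (real (g ^ q)) (real (h ^ s))"
        unfolding re using r\<delta> by linarith
      then show "16 * (real (g ^ q) - real (h ^ s))\<^sup>2 < max (real (g ^ q)) (real (h ^ s))"
        by (simp only: power2_commute)
      show "r * q \<noteq> s * p" using ratio by (simp add: mult.commute)
    qed (use g h pq rs lt g17 gh in auto)
    then show False by (rule close_powers.contradiction)
  qed
qed

end
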